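(* There exist no nontrivial progressive waves in $L^{2,1}_{\mathcal{E}}$ with $\alpha\neq0$ to the system $$i\partial_t u=\Pi(|v|^2u),\qquad i\partial_t v=\Pi(|u|^2v).$$ That is, there are no $(U,V)\in L^{2,1}_{\mathcal{E}}\times L^{2,1}_{\mathcal{E}}$ with $(U,V)\neq(0,0)$, $(\lambda,\mu)\in\mathbb{R}^2$ and $\alpha\in\mathbb{C}\setminus\{0\}$ such that $$\big(u(t,z),v(t,z)\big)=\Big(e^{-i\lambda t}U(z+\alpha t)e^{\frac12(\overline{z}\alpha-z\overline{\alpha})t},\ e^{-i\mu t}V(z+\alpha t)e^{\frac12(\overline{z}\alpha-z\overline{\alpha})t}\Big)$$ is a solution of this system.
   Context: $L$ is Lebesgue measure on $\mathbb{C}$ and $\langle z\rangle=(1+|z|^2)^{1/2}$. The Bargmann-Fock space is $\mathcal{E}=\{u(z)=e^{-|z|^2/2}f(z):\ f \text{ entire holomorphic}\}\cap L^2(\mathbb{C})$, and $L^{2,1}_{\mathcal{E}}=\{u\in\mathcal{E}:\ \langle z\rangle u\in L^2(\mathbb{C})\}$. $\Pi$ is the orthogonal projection onto $\mathcal{E}$, given by $[\Pi u](z)=\frac1\pi e^{-|z|^2/2}\int_{\mathbb{C}}e^{\overline{w}z-|w|^2/2}u(w)\,dL(w)$. A progressive wave of the system is a solution of the form displayed in the claim, for some $(\lambda,\mu)\in\mathbb{R}^2$ and $\alpha\in\mathbb{C}$. *)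

theory Defs
  imports "HOL-Complex_Analysis.Complex_Analysis"
begin

definition L2 :: "(complex \<Rightarrow> complex) set" where
  "L2 = {u. u \<in> borel_measurable lebesgue \<and> integrable lebesgue (\<lambda>z. (norm (u z))\<^sup>2)}"

definition japanese_bracket :: "complex \<Rightarrow> real" where
  "japanese_bracket z = sqrt (1 + (norm z)\<^sup>2)"

text \<open>Elements of the Bargmann-Fock space are taken as their continuous representatives, so
  equality of functions here is equality of classes in $L^2$.\<close>

definition bargmann_fock :: "(complex \<Rightarrow> complex) set" where
  "bargmann_fock =
     {u. \<exists>f. f holomorphic_on UNIV \<and> u = (\<lambda>z. of_real (exp (- (norm z)\<^sup>2 / 2)) * f z)} \<inter> L2"

definition bargmann_fock_L21 :: "(complex \<Rightarrow> complex) set" where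
  "bargmann_fock_L21 =
     {u \<in> bargmann_fock. (\<lambda>z. of_real (japanese_bracket z) * u z) \<in> L2}"

text \<open>The integrand is integrable for every \<open>u\<close> in $L^2$, so on $L^2$ the default value of the
  Bochner integral plays no role. In the system below the argument is \<open>\<bar>v\<bar>\<^sup>2 u\<close> with
  \<open>u\<close>, \<open>v\<close> in the Bargmann-Fock space; such functions are bounded, so \<open>\<bar>v\<bar>\<^sup>2 u\<close> is in
  $L^2$.\<close>

definition fock_projection :: "(complex \<Rightarrow> complex) \<Rightarrow> complex \<Rightarrow> complex" where
  "fock_projection u z =
     of_real (1 / pi * exp (- (norm z)\<^sup>2 / 2)) *
     (LINT w|lebesgue. exp (cnj w * z - of_real ((norm w)\<^sup>2 / 2)) * u w)"

text \<open>A solution is a pair of curves in the Bargmann-Fock space, defined for all real times, that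
  satisfies the equations at every time and every point, \<open>\<partial>\<^sub>t\<close> being the classical partial
  derivative. As point evaluation is continuous on the Bargmann-Fock space, every solution that
  is differentiable in time with respect to the $L^2$ norm is a solution in this sense.\<close>

definition is_solution ::
  "(real \<Rightarrow> complex \<Rightarrow> complex) \<Rightarrow> (real \<Rightarrow> complex \<Rightarrow> complex) \<Rightarrow> bool" where
  "is_solution u v \<longleftrightarrow>
     (\<forall>t. u t \<in> bargmann_fock \<and> v t \<in> bargmann_fock) \<and>
     (\<forall>t z. (\<lambda>s. u s z) differentiable (at t) \<and>
            (\<lambda>s. v s z) differentiable (at t) \<and>
            \<i> * vector_derivative (\<lambda>s. u s z) (at t) =
              fock_projection (\<lambda>w. of_real ((norm (v t w))\<^sup>2) * u t w) z \<and>
            \<i> * vector_derivative (\<lambda>s. v s z) (at t) =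
              fock_projection (\<lambda>w. of_real ((norm (u t w))\<^sup>2) * v t w) z)"

definition travelling_profile ::
  "real \<Rightarrow> complex \<Rightarrow> (complex \<Rightarrow> complex) \<Rightarrow> real \<Rightarrow> complex \<Rightarrow> complex" where
  "travelling_profile lam \<alpha> U t z =
     exp (- \<i> * of_real lam * of_real t) * U (z + \<alpha> * of_real t) *
     exp (1 / 2 * (cnj z * \<alpha> - z * cnj \<alpha>) * of_real t)"

end

theory Submission imports Defs "HOL-Probability.Distributions" begin

text \<open>
  The total momentum \<open>Q = \<integral> z (\<bar>u\<bar>\<^sup>2 + \<bar>v\<bar>\<^sup>2)\<close> is conserved by the system, whereas a wave that
  travels by \<open>\<alpha> t\<close> shifts it at the constant rate \<open>- \<alpha> (\<parallel>U\<parallel>\<^sup>2 + \<parallel>V\<parallel>\<^sup>2)\<close>. Hence \<open>\<alpha> = 0\<close> or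
  \<open>U = V = 0\<close>. The weight in \<open>L\<^sup>2\<^sup>,\<^sup>1\<close> is what makes \<open>Q\<close> finite.

  The argument is carried out at the single time \<open>t = 0\<close>. Write \<open>U = gauss * f\<close> with \<open>f\<close> entire. The
  first equation becomes \<open>gauss * (lam f + \<i> \<alpha> f' - \<i> cnj \<alpha> z f) = \<Pi> (\<bar>V\<bar>\<^sup>2 U)\<close>, and similarly for \<open>V\<close>
  (lemma \<open>stationary_equation\<close>). Pairing it with \<open>z f\<close> and with \<open>f'\<close> computes the time derivative of
  the momentum of \<open>u\<close> in two ways. On the left, differentiation and multiplication by \<open>z\<close> are adjoint
  operators with \<open>\<parallel>z f\<parallel>\<^sup>2 = \<parallel>f'\<parallel>\<^sup>2 + \<parallel>f\<parallel>\<^sup>2\<close> in the weighted norm, so only \<open>\<i> \<alpha> \<parallel>U\<parallel>\<^sup>2\<close> survives (lemma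
  \<open>momentum_balance\<close>). On the right, the projection disappears by self-adjointness (lemma
  \<open>fock_kernel_duality\<close>), and the contributions of the two equations add up to the integral of
  a \<open>\<partial>\<close>-bar derivative, of \<open>\<bar>f g\<bar>\<^sup>2 exp (- 2 \<bar>z\<bar>\<^sup>2)\<close>, which is zero (lemma \<open>momentum_cancellation\<close>).

  All the analysis rests on one integration by parts: if an integrable function on the plane has
  continuous integrable Wirtinger derivatives, these have integral zero (lemma
  \<open>integral_wirtinger_derivative_eq_0\<close>). Besides adjointness it gives mean value properties for
  entire functions, with a compactly supported weight and with the Gaussian weight. The former
  yields pointwise bounds and the square integrability of \<open>gauss * f'\<close>; the latter is
  the reproducing formula for the kernel of \<open>\<Pi>\<close>.
\<close>

section \<open>Integrals of derivatives over the plane\<close>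

lemma lborel_translation:
  fixes g :: "complex \<Rightarrow> 'b :: {banach, second_countable_topology}"
  assumes [measurable]: "g \<in> borel_measurable borel"
  shows integral_lborel_translation: "(LINT z|lborel. g (z + a)) = (LINT z|lborel. g z)"
    and integrable_lborel_translation:
      "integrable lborel (\<lambda>z. g (z + a)) \<longleftrightarrow> integrable lborel g"
proof -
  have "integral\<^sup>L (distr lborel borel ((+) a)) g = (LINT z|lborel. g (a + z))"
    by (rule integral_distr) auto
  then show "(LINT z|lborel. g (z + a)) = (LINT z|lborel. g z)"
    by (simp add: lborel_distr_plus add.commute)
  have "integrable (distr lborel borel ((+) a)) g \<longleftrightarrow> integrable lborel (\<lambda>z. g (a + z))"
    by (rule integrable_distr_eq) auto
  then show "integrable lborel (\<lambda>z. g (z + a)) \<longleftrightarrow> integrable lborel g"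
    by (simp add: lborel_distr_plus add.commute)
qed

text \<open>Translating \<open>\<phi>\<close> by \<open>d\<close> does not change its integral, so the increment
  \<open>\<phi> (z + d) - \<phi> z\<close> integrates to zero. That increment is the integral of \<open>\<psi>\<close> along the segment from
  \<open>z\<close> to \<open>z + d\<close>, and by Fubini and translation invariance its integral over \<open>z\<close> is that of \<open>\<psi>\<close>.\<close>
lemma integral_directional_derivative_eq_0:
  fixes \<phi> \<psi> :: "complex \<Rightarrow> complex"
  assumes deriv: "\<And>z. ((\<lambda>s. \<phi> (z + of_real s * d)) has_vector_derivative \<psi> z) (at 0)"
    and cont: "continuous_on UNIV \<psi>"
    and int_\<phi>: "integrable lborel \<phi>" and int_\<psi>: "integrable lborel \<psi>"
  shows "(LINT z|lborel. \<psi> z) = 0"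
proof -
  have [measurable]: "\<phi> \<in> borel_measurable borel" "\<psi> \<in> borel_measurable borel"
    using int_\<phi> int_\<psi> by (auto dest: borel_measurable_integrable)
  define f where "f = (\<lambda>s z. indicator {0..1} s *\<^sub>R \<psi> (z + of_real s * d))"
  have increment: "(LINT s|lborel. f s z) = \<phi> (z + d) - \<phi> z" for z
  proof -
    have "((\<lambda>s. \<phi> (z + of_real s * d)) has_vector_derivative \<psi> (z + of_real t * d)) (at t)" for t
    proof -
      have "((\<lambda>s. \<phi> (z + of_real t * d + of_real s * d)) has_vector_derivative
              \<psi> (z + of_real t * d)) (at (t - t))"
        using deriv[of "z + of_real t * d"] by simp
      then have "(((\<lambda>s. \<phi> (z + of_real t * d + of_real s * d)) \<circ> (\<lambda>s. s - t))
              has_vector_derivative (1 *\<^sub>R \<psi> (z + of_real t * d))) (at t)"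
        by (intro vector_diff_chain_at) (auto intro!: derivative_eq_intros)
      moreover have "(\<lambda>s. \<phi> (z + of_real t * d + of_real s * d)) \<circ> (\<lambda>s. s - t)
            = (\<lambda>s. \<phi> (z + of_real s * d))"
        by (auto simp: fun_eq_iff algebra_simps)
      ultimately show ?thesis by simp
    qed
    then have "(LINT s|lborel. indicator {0..1} s *\<^sub>R \<psi> (z + of_real s * d))
        = \<phi> (z + of_real 1 * d) - \<phi> (z + of_real 0 * d)"
      by (intro integral_FTC_atLeastAtMost)
         (auto intro: has_vector_derivative_at_within
               intro!: continuous_intros continuous_on_compose2[OF cont])
    then show ?thesis by (simp add: f_def)
  qed
  have [measurable]: "case_prod f \<in> borel_measurable (lborel \<Otimes>\<^sub>M lborel)"
    unfolding f_def by measurable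
  have norm_f: "(LINT z|lborel. norm (f s z)) = indicator {0..1} s * (LINT z|lborel. norm (\<psi> z))" for s
    using integral_lborel_translation[of "\<lambda>z. norm (\<psi> z)" "of_real s * d"]
    by (simp add: f_def)
  have "integrable (lborel \<Otimes>\<^sub>M lborel) (case_prod f)"
  proof (rule lborel_pair.Fubini_integrable)
    show "integrable lborel (\<lambda>s. LINT z|lborel. norm (case_prod f (s, z)))"
      by (simp add: norm_f)
    show "AE s in lborel. integrable lborel (\<lambda>z. case_prod f (s, z))"
      using int_\<psi> by (simp add: f_def integrable_lborel_translation)
  qed simp
  then have "(LINT z|lborel. LINT s|lborel. f s z) = (LINT s|lborel. LINT z|lborel. f s z)"
    by (rule lborel_pair.Fubini_integral)
  also have "\<dots> = (LINT z|lborel. \<psi> z)"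
    by (simp add: f_def integral_lborel_translation)
  also have "(LINT z|lborel. LINT s|lborel. f s z) = 0"
    using int_\<phi> by (simp add: increment integrable_lborel_translation integral_lborel_translation)
  finally show ?thesis by simp
qed

text \<open>Here \<open>P\<close> and \<open>Q\<close> are the Wirtinger derivatives \<open>\<partial>\<phi>\<close> and \<open>\<partial>\<close>-bar \<open>\<phi>\<close>. The directions
  \<open>1\<close> and \<open>\<i>\<close> give two linear equations for their integrals, which force both to vanish.\<close>
lemma integral_wirtinger_derivative_eq_0:
  fixes \<phi> P Q :: "complex \<Rightarrow> complex"
  assumes deriv: "\<And>z. (\<phi> has_derivative (\<lambda>d. d * P z + cnj d * Q z)) (at z)"
    and cont: "continuous_on UNIV P" "continuous_on UNIV Q"
    and int: "integrable lborel \<phi>" "integrable lborel P" "integrable lborel Q"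
  shows "(LINT z|lborel. P z) = 0" "(LINT z|lborel. Q z) = 0"
proof -
  have *: "d * (LINT z|lborel. P z) + cnj d * (LINT z|lborel. Q z) = 0" for d
  proof -
    have "((\<lambda>s. \<phi> (z + of_real s * d)) has_vector_derivative (d * P z + cnj d * Q z)) (at 0)" for z
    proof -
      have "((\<lambda>s. z + of_real s * d) has_derivative (\<lambda>s. of_real s * d)) (at 0)"
        by (auto intro!: derivative_eq_intros)
      moreover have "(\<phi> has_derivative (\<lambda>d. d * P z + cnj d * Q z)) (at (z + of_real 0 * d))"
        using deriv[of z] by simp
      ultimately have "((\<lambda>s. \<phi> (z + of_real s * d)) has_derivative
          (\<lambda>s. of_real s * d * P z + cnj (of_real s * d) * Q z)) (at 0)"
        by (rule has_derivative_compose)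
      then show ?thesis
        by (simp add: has_vector_derivative_def scaleR_conv_of_real algebra_simps)
    qed
    then have "(LINT z|lborel. d * P z + cnj d * Q z) = 0"
      by (rule integral_directional_derivative_eq_0)
         (use int in \<open>auto intro!: continuous_intros cont\<close>)
    then show ?thesis using int by simp
  qed
  from *[of 1] *[of \<i>] show "(LINT z|lborel. P z) = 0" "(LINT z|lborel. Q z) = 0"
    by (auto simp: complex_eq_iff)
qed

section \<open>Local estimates for entire functions\<close>

lemma continuous_on_entire:
  "h holomorphic_on UNIV \<Longrightarrow> continuous_on A f \<Longrightarrow> continuous_on A (\<lambda>x. h (f x))"
  by (rule continuous_on_compose2[OF holomorphic_on_imp_continuous_on]) auto

lemma holomorphic_on_entire:
  "h holomorphic_on UNIV \<Longrightarrow> f holomorphic_on A \<Longrightarrow> (\<lambda>x. h (f x)) holomorphic_on A"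
  using holomorphic_on_compose_gen[of f A h UNIV] by (simp add: comp_def)

lemma holomorphic_deriv_UNIV: "h holomorphic_on UNIV \<Longrightarrow> deriv h holomorphic_on UNIV"
  by (rule holomorphic_deriv) auto

lemma has_derivative_entire:
  assumes "h holomorphic_on UNIV"
  shows "(h has_derivative (\<lambda>d. d * deriv h z)) (at z)"
proof -
  have "(h has_field_derivative deriv h z) (at z)"
    using holomorphic_derivI[OF assms, of z] by simp
  then show ?thesis
    by (simp add: has_field_derivative_def mult.commute[of _ "deriv h z"])
qed

lemma continuous_integral_eq_0_imp_eq_0:
  fixes f :: "complex \<Rightarrow> real"
  assumes "continuous_on UNIV f" "integrable lborel f" "\<And>z. f z \<ge> 0" "(LINT z|lborel. f z) = 0"
  shows "f z = 0"
proof -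
  have "AE z in lborel. f z = 0"
    using assms by (subst (asm) integral_nonneg_eq_0_iff_AE) auto
  then have "AE z in lebesgue. z \<in> {z. f z = 0}"
    by (auto intro: AE_completion)
  moreover have "closed {z. f z = 0}"
    using assms(1) by (intro closed_Collect_eq continuous_intros)
  ultimately show ?thesis
    using mem_closed_if_AE_lebesgue by blast
qed

lemma integrable_continuous_compact_support:
  fixes f :: "complex \<Rightarrow> 'b :: {banach, second_countable_topology}"
  assumes "continuous_on UNIV f" "compact S" "\<And>z. z \<notin> S \<Longrightarrow> f z = 0"
  shows "integrable lborel f"
proof -
  have "integrable lborel (\<lambda>z. indicator S z *\<^sub>R f z)"
    using assms by (intro borel_integrable_compact) (auto intro: continuous_on_subset)
  also have "(\<lambda>z. indicator S z *\<^sub>R f z) = f"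
    using assms(3) by (auto simp: fun_eq_iff indicator_def)
  finally show ?thesis .
qed

text \<open>A compactly supported radial weight. Its square is continuously differentiable with
  \<open>\<partial>\<close>-bar derivative \<open>- 2 * bump z * z\<close>, so it turns integration by parts into a mean value
  property for the weight \<open>bump\<close> itself.\<close>
definition bump :: "complex \<Rightarrow> real" where
  "bump z = max 0 (1 - (norm z)\<^sup>2)"

lemma bump_nonneg: "0 \<le> bump z" and bump_le_1: "bump z \<le> 1"
  by (auto simp: bump_def)

lemma bump_0: "bump 0 = 1"
  by (simp add: bump_def)

lemma bump_eq_0: "z \<notin> cball 0 1 \<Longrightarrow> bump z = 0"
  using one_le_power[of "norm z" 2] by (auto simp: bump_def)

lemma continuous_on_bump [continuous_intros]: "continuous_on A bump"
  unfolding bump_def by (intro continuous_intros)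

lemma has_real_derivative_pos_part_squared:
  "((\<lambda>x::real. (max 0 x)\<^sup>2) has_real_derivative 2 * max 0 x) (at x)"
proof (cases x "0::real" rule: linorder_cases)
  case less
  have "((\<lambda>x::real. 0) has_real_derivative 0) (at x)" by simp
  then have "((\<lambda>x::real. (max 0 x)\<^sup>2) has_real_derivative 0) (at x)"
    by (rule has_field_derivative_transform_within_open[where S = "{..<0}"]) (use less in auto)
  then show ?thesis using less by simp
next
  case greater
  have "((\<lambda>x::real. x\<^sup>2) has_real_derivative 2 * x) (at x)"
    by (auto intro!: derivative_eq_intros)
  then have "((\<lambda>x::real. (max 0 x)\<^sup>2) has_real_derivative 2 * x) (at x)"
    by (rule has_field_derivative_transform_within_open[where S = "{0<..}"]) (use greater in auto)
  then show ?thesis using greater by simp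
next
  case equal
  have "((\<lambda>h::real. (max 0 h)\<^sup>2 / h) \<longlongrightarrow> 0) (at 0)"
  proof (rule tendsto_0_le[where K = 1])
    show "((\<lambda>h::real. h) \<longlongrightarrow> 0) (at 0)" by (rule tendsto_ident_at)
    show "\<forall>\<^sub>F h in at 0. norm ((max 0 h)\<^sup>2 / h) \<le> norm (h::real) * 1"
      by (intro always_eventually) (auto simp: max_def power2_eq_square)
  qed
  then show ?thesis using equal by (simp add: DERIV_def)
qed

lemma has_derivative_bump_squared:
  "((\<lambda>z. (bump z)\<^sup>2) has_derivative (\<lambda>d. - 4 * bump z * (z \<bullet> d))) (at z)"
proof -
  have "((\<lambda>z. 1 - (norm z)\<^sup>2) has_derivative (\<lambda>d. - 2 * (z \<bullet> d))) (at z)"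
    unfolding power2_norm_eq_inner
    by (auto intro!: derivative_eq_intros simp: inner_commute)
  then have "((\<lambda>z. (max 0 (1 - (norm z)\<^sup>2))\<^sup>2) has_derivative
      (\<lambda>d. (2 * max 0 (1 - (norm z)\<^sup>2)) * (- 2 * (z \<bullet> d)))) (at z)"
    by (rule has_derivative_compose[OF _ has_field_derivative_imp_has_derivative[OF
          has_real_derivative_pos_part_squared]])
  then show ?thesis by (simp add: bump_def algebra_simps)
qed

lemma two_inner_complex: "2 * of_real (z \<bullet> d) = d * cnj z + cnj d * (z::complex)"
  by (auto simp: complex_eq_iff inner_complex_def)

text \<open>Up to the factor \<open>- 2\<close>, the integrand is the \<open>\<partial>\<close>-bar derivative of \<open>bump\<^sup>2 q\<close>.\<close>
lemma integral_bump_moment: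
  assumes q: "q holomorphic_on UNIV"
  shows "(LINT z|lborel. of_real (bump z) * z * q z) = 0"
proof -
  define P where "P = (\<lambda>z. of_real ((bump z)\<^sup>2) * deriv q z - 2 * of_real (bump z) * cnj z * q z)"
  define Q where "Q = (\<lambda>z. - 2 * (of_real (bump z) * z * q z))"
  have "((\<lambda>z. of_real ((bump z)\<^sup>2) * q z) has_derivative (\<lambda>d. d * P z + cnj d * Q z)) (at z)" for z
  proof -
    have "((\<lambda>z. of_real ((bump z)\<^sup>2) * q z) has_derivative
       (\<lambda>d. of_real ((bump z)\<^sup>2) * (d * deriv q z) + of_real (- 4 * bump z * (z \<bullet> d)) * q z)) (at z)"
      by (intro has_derivative_mult has_derivative_of_real has_derivative_bump_squared
           has_derivative_entire q)
    moreover have "of_real ((bump z)\<^sup>2) * (d * deriv q z) + of_real (- 4 * bump z * (z \<bullet> d)) * q z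
        = d * P z + cnj d * Q z" for d
    proof -
      have "complex_of_real (- 4 * bump z * (z \<bullet> d)) = - 2 * of_real (bump z) * (2 * of_real (z \<bullet> d))"
        by simp
      also have "\<dots> = - 2 * of_real (bump z) * (d * cnj z + cnj d * z)"
        by (simp only: two_inner_complex)
      finally show ?thesis
        unfolding P_def Q_def by (simp only:) (simp add: algebra_simps)
    qed
    ultimately show ?thesis by simp
  qed
  moreover have "continuous_on UNIV P" "continuous_on UNIV Q"
    "continuous_on UNIV (\<lambda>z. of_real ((bump z)\<^sup>2) * q z)"
    unfolding P_def Q_def
    by (intro continuous_intros continuous_on_entire[OF q] continuous_on_entire[OF holomorphic_deriv_UNIV[OF q]])+
  moreover from this have "integrable lborel P" "integrable lborel Q"
    "integrable lborel (\<lambda>z. of_real ((bump z)\<^sup>2) * q z)"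
    by (intro integrable_continuous_compact_support[where S = "cball 0 1"] compact_cball;
        simp add: P_def Q_def bump_eq_0)+
  ultimately have "(LINT z|lborel. Q z) = 0"
    by (intro integral_wirtinger_derivative_eq_0)
  then show ?thesis by (simp add: Q_def)
qed

lemma entire_difference_quotient:
  fixes h :: "complex \<Rightarrow> complex"
  assumes "h holomorphic_on UNIV"
  obtains q where "q holomorphic_on UNIV" "\<And>z. h z = h 0 + z * q z"
proof (rule that)
  show "(\<lambda>z. if z = 0 then deriv h 0 else (h z - h 0) / (z - 0)) holomorphic_on UNIV"
    using assms by (intro pole_lemma) auto
qed simp

text \<open>Write \<open>h = h 0 + z q\<close> with \<open>q\<close> entire; the second term has vanishing weighted integral.\<close>
lemma bump_mean_value:
  assumes "h holomorphic_on UNIV"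
  shows "(LINT z|lborel. of_real (bump z) * h z) = of_real (LINT z|lborel. bump z) * h 0"
proof -
  obtain q where q: "q holomorphic_on UNIV" and h_eq: "\<And>z. h z = h 0 + z * q z"
    using that by (rule entire_difference_quotient[OF assms])
  have split: "of_real (bump z) * h z = of_real (bump z) * h 0 + of_real (bump z) * z * q z" for z
    by (subst h_eq[of z]) (simp only: ring_distribs mult.assoc)
  have "integrable lborel (\<lambda>z. of_real (bump z) * h 0)" "integrable lborel (\<lambda>z. of_real (bump z) * z * q z)"
    by (intro integrable_continuous_compact_support[where S = "cball 0 1"] compact_cball
          continuous_intros continuous_on_entire[OF q]; simp add: bump_eq_0)+
  then show ?thesis
    by (simp only: split Bochner_Integration.integral_add integral_bump_moment[OF q]) simp
qed

lemma integral_bump_pos: "0 < (LINT z|lborel. bump z)"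
proof -
  have "integrable lborel bump"
    by (rule integrable_continuous_compact_support[OF continuous_on_bump compact_cball bump_eq_0])
  then have "(LINT z|lborel. bump z) \<noteq> 0"
    using continuous_integral_eq_0_imp_eq_0[OF continuous_on_bump _ bump_nonneg, of 0] bump_0
    by auto
  moreover have "(LINT z|lborel. bump z) \<ge> 0" by (simp add: bump_nonneg)
  ultimately show ?thesis by simp
qed

lemma integrable_indicator_norm_sq:
  assumes "continuous_on UNIV X"
  shows "integrable lborel (\<lambda>z. indicator (cball w r) z * (norm (X z :: complex))\<^sup>2)"
proof -
  have "continuous_on (cball w r) (\<lambda>z. (norm (X z))\<^sup>2)"
    by (intro continuous_intros continuous_on_subset[OF assms]) auto
  from borel_integrable_compact[OF compact_cball this] show ?thesis
    by simp
qed

text \<open>The weighted mean value property applied to the entire function \<open>(h (z + w))\<^sup>2\<close>. Squaring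
  before averaging makes the integral of \<open>\<bar>h\<bar>\<^sup>2\<close> appear.\<close>
lemma entire_norm_sq_le_local_integral:
  obtains C where "0 < C"
    "\<And>h w. h holomorphic_on UNIV \<Longrightarrow>
      (norm (h w))\<^sup>2 \<le> C * (LINT z|lborel. indicator (cball w 1) z * (norm (h z :: complex))\<^sup>2)"
proof
  define c where "c = (LINT z|lborel. bump z)"
  show "0 < 1 / c" using integral_bump_pos by (simp add: c_def)
  fix h :: "complex \<Rightarrow> complex" and w
  assume h: "h holomorphic_on UNIV"
  have hol: "(\<lambda>z. (h (z + w))\<^sup>2) holomorphic_on UNIV"
    by (intro holomorphic_on_power holomorphic_on_entire[OF h] holomorphic_intros)
  have "c * (norm (h w))\<^sup>2 = norm (LINT z|lborel. of_real (bump z) * (h (z + w))\<^sup>2)"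
    using bump_mean_value[OF hol] integral_bump_pos
    by (simp add: c_def norm_mult norm_power)
  also have "\<dots> \<le> (LINT z|lborel. norm (of_real (bump z) * (h (z + w))\<^sup>2))"
    by (rule integral_norm_bound)
  also have "\<dots> \<le> (LINT z|lborel. indicator (cball 0 1) z * (norm (h (z + w)))\<^sup>2)"
  proof (rule integral_mono)
    show "integrable lborel (\<lambda>z. norm (of_real (bump z) * (h (z + w))\<^sup>2))"
      by (intro integrable_norm integrable_continuous_compact_support[where S = "cball 0 1"]
            compact_cball continuous_intros continuous_on_entire[OF h]) (simp add: bump_eq_0)
    show "integrable lborel (\<lambda>z. indicator (cball 0 1) z * (norm (h (z + w)))\<^sup>2)"
      by (intro integrable_indicator_norm_sq continuous_intros continuous_on_entire[OF h])
    show "norm (of_real (bump z) * (h (z + w))\<^sup>2) \<le> indicator (cball 0 1) z * (norm (h (z + w)))\<^sup>2" for z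
    proof (cases "z \<in> cball 0 1")
      case True
      then show ?thesis
        using mult_left_le_one_le[of "(norm (h (z + w)))\<^sup>2" "bump z"] bump_nonneg[of z] bump_le_1[of z]
        by (simp add: norm_mult norm_power)
    qed (simp add: bump_eq_0)
  qed
  also have "\<dots> = (LINT z|lborel. indicator (cball w 1) (z + w) * (norm (h (z + w)))\<^sup>2)"
    by (intro Bochner_Integration.integral_cong) (auto simp: indicator_def dist_norm)
  also have "\<dots> = (LINT z|lborel. indicator (cball w 1) z * (norm (h z))\<^sup>2)"
    using borel_measurable_integrable[OF integrable_indicator_norm_sq[OF
        holomorphic_on_imp_continuous_on[OF h], of w 1]]
    by (intro integral_lborel_translation) simp
  finally show "(norm (h w))\<^sup>2 \<le> 1 / c * (LINT z|lborel. indicator (cball w 1) z * (norm (h z))\<^sup>2)"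
    using integral_bump_pos by (simp add: c_def field_simps)
qed

lemma entire_deriv_norm_le:
  assumes "h holomorphic_on UNIV" "\<And>w. norm (w - a) = 1 \<Longrightarrow> norm (h w) \<le> B"
  shows "norm (deriv h a) \<le> B"
proof -
  have "norm ((deriv ^^ 1) h a) \<le> fact 1 * B / 1 ^ 1"
    by (intro Cauchy_inequality holomorphic_on_subset[OF assms(1)] continuous_on_entire[OF assms(1)]
          continuous_intros assms(2))
       (auto simp: norm_minus_commute)
  then show ?thesis by simp
qed

text \<open>Cauchy's inequality on the unit circle around \<open>w\<close>, where the previous bound applies: each unit
  disc around a point of that circle lies in the disc of radius \<open>2\<close> around \<open>w\<close>.\<close>
lemma entire_deriv_norm_sq_le_local_integral:
  obtains C where "0 < C"
    "\<And>h w. h holomorphic_on UNIV \<Longrightarrow>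
      (norm (deriv h w))\<^sup>2 \<le> C * (LINT z|lborel. indicator (cball w 2) z * (norm (h z :: complex))\<^sup>2)"
proof -
  obtain C where C: "0 < C" "\<And>h w. h holomorphic_on UNIV \<Longrightarrow>
      (norm (h w))\<^sup>2 \<le> C * (LINT z|lborel. indicator (cball w 1) z * (norm (h z :: complex))\<^sup>2)"
    using entire_norm_sq_le_local_integral by metis
  show thesis
  proof (rule that[OF C(1)])
    fix h :: "complex \<Rightarrow> complex" and w
    assume h: "h holomorphic_on UNIV"
    define I where "I = (LINT z|lborel. indicator (cball w 2) z * (norm (h z))\<^sup>2)"
    have h_le: "norm (h v) \<le> sqrt (C * I)" if "norm (v - w) = 1" for v
    proof -
      have "(norm (h v))\<^sup>2 \<le> C * (LINT z|lborel. indicator (cball v 1) z * (norm (h z))\<^sup>2)"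
        using C(2)[OF h] .
      also have "\<dots> \<le> C * I"
        unfolding I_def
      proof (intro mult_left_mono integral_mono integrable_indicator_norm_sq)
        have "cball v 1 \<subseteq> cball w 2"
          using that by (simp add: cball_subset_cball_iff dist_norm)
        then show "indicator (cball v 1) z * (norm (h z))\<^sup>2 \<le> indicator (cball w 2) z * (norm (h z))\<^sup>2" for z
          by (auto simp: indicator_def)
      qed (use C(1) holomorphic_on_imp_continuous_on[OF h] in simp_all)
      finally show ?thesis by (rule real_le_rsqrt)
    qed
    have "norm (deriv h w) \<le> sqrt (C * I)"
      by (rule entire_deriv_norm_le[OF h h_le])
    moreover have "0 \<le> C * I"
      using C(1) by (simp add: I_def)
    ultimately show "(norm (deriv h w))\<^sup>2 \<le> C * I"
      using power_mono[of "norm (deriv h w)" "sqrt (C * I)" 2] by simp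
  qed
qed

section \<open>Square-integrable functions and Gaussian integrals\<close>

text \<open>A complex-valued form of \<open>exp (- \<bar>z\<bar>\<^sup>2 / 2)\<close>, which makes its Wirtinger derivatives and the
  exponent identities below direct computations.\<close>
definition gauss :: "complex \<Rightarrow> complex" where
  "gauss z = exp (- (z * cnj z) / 2)"

lemma gauss_eq_of_real: "gauss z = of_real (exp (- (norm z)\<^sup>2 / 2))"
  by (simp add: gauss_def exp_of_real[symmetric] complex_norm_square[symmetric] del: exp_of_real)

lemma norm_gauss: "norm (gauss z) = exp (- (norm z)\<^sup>2 / 2)"
  by (simp add: gauss_eq_of_real)

lemma cnj_gauss [simp]: "cnj (gauss z) = gauss z"
  by (simp add: gauss_eq_of_real)

lemma continuous_on_gauss [continuous_intros]:
  "continuous_on A f \<Longrightarrow> continuous_on A (\<lambda>x. gauss (f x))"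
  unfolding gauss_def by (intro continuous_intros) auto

definition square_integrable :: "(complex \<Rightarrow> complex) \<Rightarrow> bool" where
  "square_integrable X \<longleftrightarrow> continuous_on UNIV X \<and> integrable lborel (\<lambda>z. (norm (X z))\<^sup>2)"

lemma integrable_continuous_bound:
  fixes f :: "complex \<Rightarrow> 'b :: {banach, second_countable_topology}"
  assumes "integrable lborel g" "continuous_on UNIV f" "\<And>z. norm (f z) \<le> (g z :: real)"
  shows "integrable lborel f"
proof (rule Bochner_Integration.integrable_bound[OF assms(1)])
  show "f \<in> borel_measurable lborel"
    using borel_measurable_continuous_onI[OF assms(2)] by simp
  show "AE z in lborel. norm (f z) \<le> norm (g z)"
    using assms(3) by (auto intro!: AE_I2 order_trans[OF assms(3)])
qed

lemma integrable_mult_square_integrable: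
  assumes "square_integrable X" "square_integrable Y"
  shows "integrable lborel (\<lambda>z. X z * Y z)"
proof (rule integrable_continuous_bound)
  show "integrable lborel (\<lambda>z. (norm (X z))\<^sup>2 + (norm (Y z))\<^sup>2)"
    using assms by (simp add: square_integrable_def)
  show "continuous_on UNIV (\<lambda>z. X z * Y z)"
    using assms by (auto simp: square_integrable_def intro!: continuous_intros)
  show "norm (X z * Y z) \<le> (norm (X z))\<^sup>2 + (norm (Y z))\<^sup>2" for z
  proof -
    have "0 \<le> norm (X z) * norm (Y z)" by simp
    with sum_squares_bound[of "norm (X z)" "norm (Y z)"] show ?thesis
      unfolding norm_mult by linarith
  qed
qed

lemma square_integrable_bound:
  assumes "square_integrable X" "continuous_on UNIV Y" "\<And>z. norm (Y z) \<le> B * norm (X z)"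
  shows "square_integrable Y"
  unfolding square_integrable_def
proof
  have "integrable lborel (\<lambda>z. B\<^sup>2 * (norm (X z))\<^sup>2)"
    using assms by (simp add: square_integrable_def)
  then show "integrable lborel (\<lambda>z. (norm (Y z))\<^sup>2)"
  proof (rule integrable_continuous_bound)
    show "norm ((norm (Y z))\<^sup>2) \<le> B\<^sup>2 * (norm (X z))\<^sup>2" for z
      using power_mono[OF assms(3), of z 2] by (simp add: power_mult_distrib)
  qed (intro continuous_intros assms)
qed fact

lemma square_integrable_cnj:
  "square_integrable X \<Longrightarrow> square_integrable (\<lambda>z. cnj (X z))"
  by (auto simp: square_integrable_def intro!: continuous_intros)

lemma integrable_mult_cnj_square_integrable:
  assumes "square_integrable X" "square_integrable Y"
  shows "integrable lborel (\<lambda>z. X z * cnj (Y z))"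
  by (intro integrable_mult_square_integrable square_integrable_cnj assms)

lemma square_integrable_mult_bounded:
  assumes "square_integrable X" "continuous_on UNIV Y" "\<And>z. norm (Y z) \<le> B"
  shows "square_integrable (\<lambda>z. Y z * X z)"
proof (rule square_integrable_bound[OF assms(1)])
  show "continuous_on UNIV (\<lambda>z. Y z * X z)"
    using assms by (auto simp: square_integrable_def intro!: continuous_intros)
  show "norm (Y z * X z) \<le> B * norm (X z)" for z
    unfolding norm_mult by (intro mult_right_mono assms) simp
qed

lemma square_integrable_add:
  assumes "square_integrable X" "square_integrable Y"
  shows "square_integrable (\<lambda>z. X z + Y z)"
  unfolding square_integrable_def
proof
  show *: "continuous_on UNIV (\<lambda>z. X z + Y z)"
    using assms by (auto simp: square_integrable_def intro!: continuous_intros)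
  have "integrable lborel (\<lambda>z. 2 * (norm (X z))\<^sup>2 + 2 * (norm (Y z))\<^sup>2)"
    using assms by (simp add: square_integrable_def)
  then show "integrable lborel (\<lambda>z. (norm (X z + Y z))\<^sup>2)"
  proof (rule integrable_continuous_bound)
    show "norm ((norm (X z + Y z))\<^sup>2) \<le> 2 * (norm (X z))\<^sup>2 + 2 * (norm (Y z))\<^sup>2" for z
      using power_mono[OF norm_triangle_ineq[of "X z" "Y z"], of 2]
        sum_squares_bound[of "norm (X z)" "norm (Y z)"]
      by (simp add: power2_sum)
  qed (intro continuous_intros *)
qed

text \<open>The integral factorises over the two coordinates, each factor being a multiple of a normal
  density.\<close>
lemma gaussian_integral:
  assumes "0 < c"
  shows integrable_gaussian: "integrable lborel (\<lambda>z::complex. exp (- c * (norm z)\<^sup>2))"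
    and integral_gaussian: "(LINT z|lborel. exp (- c * (norm (z::complex))\<^sup>2)) = pi / c"
proof -
  define \<sigma> where "\<sigma> = sqrt (1 / (2 * c))"
  have \<sigma>: "\<sigma> > 0" "\<sigma>\<^sup>2 = 1 / (2 * c)" using assms by (auto simp: \<sigma>_def)
  have eq: "exp (- c * x\<^sup>2) = sqrt (pi / c) * normal_density 0 \<sigma> x" for x
    using assms by (simp add: normal_density_def \<sigma>(2) real_sqrt_divide field_simps)
  have one: "(\<integral>\<^sup>+x. ennreal (exp (- c * x\<^sup>2)) \<partial>lborel) = ennreal (sqrt (pi / c))"
  proof (subst nn_integral_eq_integral)
    show "integrable lborel (\<lambda>x. exp (- c * x\<^sup>2))"
      unfolding eq using \<sigma>(1) by simp
    show "ennreal (LINT x|lborel. exp (- c * x\<^sup>2)) = ennreal (sqrt (pi / c))"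
      unfolding eq using \<sigma>(1) by simp
  qed auto
  have "(\<integral>\<^sup>+z. (\<Prod>b\<in>Basis. ennreal (exp (- c * (z \<bullet> b)\<^sup>2))) \<partial>(lborel :: complex measure))
      = (\<Prod>b\<in>(Basis :: complex set). (\<integral>\<^sup>+x. ennreal (exp (- c * x\<^sup>2)) \<partial>lborel))"
    by (rule nn_integral_lborel_prod) auto
  also have "\<dots> = ennreal (pi / c)"
    unfolding one using assms by (simp add: Basis_complex_def ennreal_mult[symmetric])
  also have "(\<lambda>z::complex. \<Prod>b\<in>Basis. ennreal (exp (- c * (z \<bullet> b)\<^sup>2)))
     = (\<lambda>z. ennreal (exp (- c * (norm z)\<^sup>2)))"
    by (auto simp: Basis_complex_def ennreal_mult[symmetric] mult_exp_exp cmod_power2 algebra_simps inner_complex_def)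
  finally have nn: "(\<integral>\<^sup>+z. ennreal (exp (- c * (norm (z::complex))\<^sup>2)) \<partial>lborel) = ennreal (pi / c)" .
  then show "integrable lborel (\<lambda>z::complex. exp (- c * (norm z)\<^sup>2))"
    by (intro integrableI_bounded) auto
  have "(LINT z|lborel. exp (- c * (norm (z::complex))\<^sup>2))
      = enn2real (\<integral>\<^sup>+z. ennreal (exp (- c * (norm (z::complex))\<^sup>2)) \<partial>lborel)"
    by (rule integral_eq_nn_integral) auto
  then show "(LINT z|lborel. exp (- c * (norm (z::complex))\<^sup>2)) = pi / c"
    unfolding nn using assms by simp
qed

section \<open>Translations of the Fock space\<close>

text \<open>The Weyl translation: on the functions \<open>u = gauss * h\<close> it acts, up to a unimodular factor, as
  \<open>u (z + a)\<close>. It carries estimates at the origin to estimates at \<open>a\<close> without loss.\<close>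
definition fock_translate :: "complex \<Rightarrow> (complex \<Rightarrow> complex) \<Rightarrow> complex \<Rightarrow> complex" where
  "fock_translate a h z = h (z + a) * exp (- z * cnj a - a * cnj a / 2)"

lemma gauss_fock_translate:
  "gauss z * fock_translate a h z = exp ((cnj z * a - z * cnj a) / 2) * (gauss (z + a) * h (z + a))"
proof -
  have "gauss z * exp (- z * cnj a - a * cnj a / 2) = exp ((cnj z * a - z * cnj a) / 2) * gauss (z + a)"
    unfolding gauss_def mult_exp_exp by (rule arg_cong[of _ _ exp]) (simp add: field_simps)
  then show ?thesis by (simp add: fock_translate_def mult_ac)
qed

lemma norm_gauss_fock_translate:
  "norm (gauss z * fock_translate a h z) = norm (gauss (z + a) * h (z + a))"
  unfolding gauss_fock_translate norm_mult[of "exp _"] by simp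

lemma holomorphic_fock_translate:
  assumes "h holomorphic_on UNIV"
  shows "fock_translate a h holomorphic_on UNIV"
  unfolding fock_translate_def
  by (intro holomorphic_intros holomorphic_on_entire[OF assms])

lemma fock_translate_0: "fock_translate a h 0 = gauss a * h a"
  by (simp add: fock_translate_def gauss_def mult.commute)

lemma deriv_fock_translate_0:
  assumes "h holomorphic_on UNIV"
  shows "deriv (fock_translate a h) 0 = gauss a * (deriv h a - cnj a * h a)"
proof (rule DERIV_imp_deriv)
  have "(h has_field_derivative deriv h (0 + a)) (at (0 + a))"
    using holomorphic_derivI[OF assms] by simp
  then have "((\<lambda>z. h (z + a)) has_field_derivative deriv h a) (at 0)"
    by (subst (asm) DERIV_shift) simp
  then have "((\<lambda>z. h (z + a) * exp (- z * cnj a - a * cnj a / 2)) has_field_derivative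
      gauss a * (deriv h a - cnj a * h a)) (at 0)"
    by (auto intro!: derivative_eq_intros simp: gauss_def algebra_simps)
  then show "(fock_translate a h has_field_derivative gauss a * (deriv h a - cnj a * h a)) (at 0)"
    by (simp add: fock_translate_def[abs_def])
qed

lemma fock_translate_local_integral_le:
  assumes h: "h holomorphic_on UNIV"
  shows "(LINT z|lborel. indicator (cball 0 r) z * (norm (fock_translate a h z))\<^sup>2)
      \<le> exp (r\<^sup>2) * (LINT z|lborel. indicator (cball 0 r) z * (norm (gauss (z + a) * h (z + a)))\<^sup>2)"
proof -
  have "(norm (fock_translate a h z))\<^sup>2 \<le> exp (r\<^sup>2) * (norm (gauss (z + a) * h (z + a)))\<^sup>2"
    if "norm z \<le> r" for z
  proof -
    have "norm (fock_translate a h z) = exp ((norm z)\<^sup>2 / 2) * norm (gauss (z + a) * h (z + a))"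
      unfolding norm_gauss_fock_translate[symmetric, of z a h] norm_mult[of "gauss z"] norm_gauss
      by (simp add: exp_minus field_simps)
    then have "(norm (fock_translate a h z))\<^sup>2 = exp ((norm z)\<^sup>2) * (norm (gauss (z + a) * h (z + a)))\<^sup>2"
      by (simp only: power_mult_distrib exp_double[symmetric]) simp
    also have "\<dots> \<le> exp (r\<^sup>2) * (norm (gauss (z + a) * h (z + a)))\<^sup>2"
      using that by (intro mult_right_mono) (auto intro!: power_mono)
    finally show ?thesis .
  qed
  then have "(LINT z|lborel. indicator (cball 0 r) z * (norm (fock_translate a h z))\<^sup>2)
    \<le> (LINT z|lborel. exp (r\<^sup>2) * (indicator (cball 0 r) z * (norm (gauss (z + a) * h (z + a)))\<^sup>2))"
  proof (intro integral_mono integrable_mult_right integrable_indicator_norm_sq)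
    show "continuous_on UNIV (fock_translate a h)"
      by (rule holomorphic_on_imp_continuous_on[OF holomorphic_fock_translate[OF h]])
    show "continuous_on UNIV (\<lambda>z. gauss (z + a) * h (z + a))"
      by (intro continuous_intros continuous_on_entire[OF h])
  qed (auto simp: indicator_def)
  then show ?thesis by (simp only: integral_mult_right_zero)
qed

text \<open>The local bound at the origin for the translates, whose \<open>L\<^sup>2\<close> norms do not depend on the
  translation.\<close>
lemma fock_bounded:
  assumes h: "h holomorphic_on UNIV" and sq: "square_integrable (\<lambda>z. gauss z * h z)"
  obtains B where "\<And>z. norm (gauss z * h z) \<le> B"
proof -
  obtain C where C: "0 < C" "\<And>h w. h holomorphic_on UNIV \<Longrightarrow>
      (norm (h w))\<^sup>2 \<le> C * (LINT z|lborel. indicator (cball w 1) z * (norm (h z :: complex))\<^sup>2)"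
    using entire_norm_sq_le_local_integral by metis
  define I where "I = (LINT z|lborel. (norm (gauss z * h z))\<^sup>2)"
  have int: "integrable lborel (\<lambda>z. (norm (gauss z * h z))\<^sup>2)"
    using sq by (simp add: square_integrable_def)
  then have meas: "(\<lambda>z. (norm (gauss z * h z))\<^sup>2) \<in> borel_measurable borel"
    using borel_measurable_integrable by fastforce
  have "norm (gauss a * h a) \<le> sqrt (C * exp 1 * I)" for a
  proof (rule real_le_rsqrt)
    have "(norm (gauss a * h a))\<^sup>2 \<le>
        C * (LINT z|lborel. indicator (cball 0 1) z * (norm (fock_translate a h z))\<^sup>2)"
      using C(2)[OF holomorphic_fock_translate[OF h], of a 0] by (simp only: fock_translate_0)
    also have "\<dots> \<le> C * (exp (1\<^sup>2) *
        (LINT z|lborel. indicator (cball 0 1) z * (norm (gauss (z + a) * h (z + a)))\<^sup>2))"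
      using C(1) by (intro mult_left_mono fock_translate_local_integral_le h) auto
    also have "\<dots> \<le> C * (exp (1\<^sup>2) * (LINT z|lborel. (norm (gauss (z + a) * h (z + a)))\<^sup>2))"
      using C(1)
      by (intro mult_left_mono integral_mono integrable_indicator_norm_sq continuous_intros
          continuous_on_entire[OF h])
         (auto simp: integrable_lborel_translation[OF meas] int indicator_def
               simp del: norm_mult)
    also have "\<dots> = C * exp 1 * I"
      using integral_lborel_translation[OF meas] by (simp add: I_def del: norm_mult)
    finally show "(norm (gauss a * h a))\<^sup>2 \<le> C * exp 1 * I" .
  qed
  then show thesis by (rule that)
qed

text \<open>\<open>h' - cnj z h\<close> at \<open>a\<close>, weighted by \<open>gauss\<close>, is the derivative at the origin of the translate by
  \<open>a\<close>. Its square is hence bounded by the local mass of \<open>gauss * h\<close> near \<open>a\<close>, and integrating the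
  local mass over \<open>a\<close> gives a multiple of the total mass. Neither term of the difference need be
  square integrable alone.\<close>
lemma square_integrable_twisted_deriv:
  assumes h: "h holomorphic_on UNIV" and sq: "square_integrable (\<lambda>z. gauss z * h z)"
  shows "square_integrable (\<lambda>z. gauss z * (deriv h z - cnj z * h z))"
  unfolding square_integrable_def
proof
  show cont: "continuous_on UNIV (\<lambda>z. gauss z * (deriv h z - cnj z * h z))"
    by (intro continuous_intros continuous_on_entire[OF h]
        continuous_on_entire[OF holomorphic_deriv_UNIV[OF h]])
  obtain C where C: "0 < C" "\<And>h w. h holomorphic_on UNIV \<Longrightarrow>
      (norm (deriv h w))\<^sup>2 \<le> C * (LINT z|lborel. indicator (cball w 2) z * (norm (h z :: complex))\<^sup>2)"
    using entire_deriv_norm_sq_le_local_integral by metis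
  define X where "X = (\<lambda>z. (norm (gauss z * h z))\<^sup>2)"
  define f where "f = (\<lambda>z a. indicator (cball 0 2) z * X (z + a) :: real)"
  have int: "integrable lborel X"
    using sq by (simp add: square_integrable_def X_def)
  then have [measurable]: "X \<in> borel_measurable borel"
    using borel_measurable_integrable by fastforce
  have int': "integrable lborel (\<lambda>a. X (z + a))" for z
    using integrable_lborel_translation[of X z] int by (simp add: add.commute)
  have integral': "(LINT a|lborel. X (z + a)) = (LINT a|lborel. X a)" for z
    using integral_lborel_translation[of X z] by (simp add: add.commute)
  have X_nonneg: "X z \<ge> 0" for z by (simp add: X_def)
  have [measurable]: "(cball 0 2 :: complex set) \<in> sets borel" by simp
  have [measurable]: "case_prod f \<in> borel_measurable (lborel \<Otimes>\<^sub>M lborel)"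
    unfolding f_def by measurable
  have "integrable (lborel \<Otimes>\<^sub>M lborel) (case_prod f)"
  proof (rule lborel_pair.Fubini_integrable)
    have "(LINT a|lborel. norm (case_prod f (z, a))) = indicator (cball 0 2) z * (LINT a|lborel. X a)" for z
      by (simp add: f_def abs_mult X_nonneg integral')
    moreover have "integrable lborel (\<lambda>z::complex. indicator (cball 0 2) z * (LINT a|lborel. X a))"
      using emeasure_lborel_cball_finite[of 0 2]
      by (intro integrable_mult_left integrable_real_indicator) auto
    ultimately show "integrable lborel (\<lambda>z. LINT a|lborel. norm (case_prod f (z, a)))"
      by simp
    show "AE z in lborel. integrable lborel (\<lambda>a. case_prod f (z, a))"
      by (simp add: f_def int')
  qed simp
  then have "integrable lborel (\<lambda>a. LINT z|lborel. f z a)"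
    by (rule lborel_pair.integrable_snd)
  then have "integrable lborel (\<lambda>a. C * exp (2\<^sup>2) * (LINT z|lborel. f z a))"
    by (rule integrable_mult_right)
  then show "integrable lborel (\<lambda>z. (norm (gauss z * (deriv h z - cnj z * h z)))\<^sup>2)"
  proof (rule integrable_continuous_bound)
    fix a
    have "(norm (gauss a * (deriv h a - cnj a * h a)))\<^sup>2
      \<le> C * (LINT z|lborel. indicator (cball 0 2) z * (norm (fock_translate a h z))\<^sup>2)"
      using C(2)[OF holomorphic_fock_translate[OF h], of a 0]
      by (simp only: deriv_fock_translate_0[OF h])
    also have "\<dots> \<le> C * (exp (2\<^sup>2) *
        (LINT z|lborel. indicator (cball 0 2) z * (norm (gauss (z + a) * h (z + a)))\<^sup>2))"
      using C(1) by (intro mult_left_mono fock_translate_local_integral_le h) auto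
    finally show "norm ((norm (gauss a * (deriv h a - cnj a * h a)))\<^sup>2)
        \<le> C * exp (2\<^sup>2) * (LINT z|lborel. f z a)"
      by (simp only: f_def X_def mult.assoc real_norm_def abs_power2)
  qed (intro continuous_intros cont)
qed

section \<open>The adjoint of differentiation and the reproducing formula\<close>

text \<open>Differentiation and multiplication by \<open>c z\<close> are adjoint for the weight \<open>exp (- c \<bar>z\<bar>\<^sup>2)\<close>: the
  difference of the two sides is the integral of the \<open>\<partial>\<close>-bar derivative of \<open>w F cnj G\<close>. The value
  \<open>c = 1\<close> governs the Fock space, and \<open>c = 2\<close> governs products of two of its elements.\<close>
lemma fock_adjoint_deriv:
  fixes c :: real
  defines "w \<equiv> \<lambda>z. exp (- (of_real c * (z * cnj z)))"
  assumes F: "F holomorphic_on UNIV" and G: "G holomorphic_on UNIV"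
    and "integrable lborel (\<lambda>z. w z * (F z * cnj (G z)))"
        "integrable lborel (\<lambda>z. w z * (deriv F z * cnj (G z)))"
        "integrable lborel (\<lambda>z. w z * (F z * cnj (deriv G z)))"
        "integrable lborel (\<lambda>z. w z * (z * F z * cnj (G z)))"
  shows "(LINT z|lborel. w z * (F z * cnj (deriv G z)))
       = of_real c * (LINT z|lborel. w z * (z * F z * cnj (G z)))"
proof -
  define P where "P = (\<lambda>z. w z * (deriv F z * cnj (G z)) - of_real c * (w z * (cnj z * F z * cnj (G z))))"
  define Q where "Q = (\<lambda>z. w z * (F z * cnj (deriv G z)) - of_real c * (w z * (z * F z * cnj (G z))))"
  note cont = continuous_on_entire[OF F] continuous_on_entire[OF G]
     continuous_on_entire[OF holomorphic_deriv_UNIV[OF F]] continuous_on_entire[OF holomorphic_deriv_UNIV[OF G]]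
  have "((\<lambda>z. w z * (F z * cnj (G z))) has_derivative (\<lambda>d. d * P z + cnj d * Q z)) (at z)" for z
  proof -
    have dw: "(w has_derivative (\<lambda>d. w z * (- (of_real c * (z * cnj d + d * cnj z))))) (at z)"
    proof -
      have "((\<lambda>z. - (of_real c * (z * cnj z))) has_derivative
          (\<lambda>d. - (of_real c * (z * cnj d + d * cnj z)))) (at z)"
        by (intro has_derivative_minus has_derivative_mult_right has_derivative_mult
             has_derivative_ident has_derivative_cnj)
      from has_derivative_compose[OF this has_field_derivative_imp_has_derivative[OF DERIV_exp]]
      show ?thesis by (simp only: w_def)
    qed
    have "((\<lambda>z. w z * (F z * cnj (G z))) has_derivative
      (\<lambda>d. w z * (F z * cnj (d * deriv G z) + (d * deriv F z) * cnj (G z))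
         + w z * (- (of_real c * (z * cnj d + d * cnj z))) * (F z * cnj (G z)))) (at z)"
      by (intro has_derivative_mult has_derivative_cnj dw has_derivative_entire F G)
    then show ?thesis
      by (rule has_derivative_eq_rhs) (simp add: fun_eq_iff P_def Q_def algebra_simps)
  qed
  moreover have "continuous_on UNIV P" "continuous_on UNIV Q"
    unfolding P_def Q_def w_def by (intro continuous_intros cont)+
  moreover have "integrable lborel (\<lambda>z. w z * (cnj z * F z * cnj (G z)))"
  proof (rule integrable_continuous_bound[OF integrable_norm])
    show "continuous_on UNIV (\<lambda>z. w z * (cnj z * F z * cnj (G z)))"
      unfolding w_def by (intro continuous_intros cont)
    show "norm (w z * (cnj z * F z * cnj (G z))) \<le> norm (w z * (z * F z * cnj (G z)))" for z
      by (simp add: norm_mult)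
  qed fact
  ultimately have "(LINT z|lborel. Q z) = 0"
    using assms(4-7) by (intro integral_wirtinger_derivative_eq_0(2)[of "\<lambda>z. w z * (F z * cnj (G z))" P Q])
      (auto simp: P_def Q_def)
  then show ?thesis
    using assms(4-7) by (simp add: Q_def)
qed

lemma gauss_squared: "gauss z * gauss z = exp (- (z * cnj z))"
  by (simp add: gauss_def mult_exp_exp)

lemma norm_le_exp: "norm (z::complex) \<le> exp ((norm z)\<^sup>2 / 4)"
proof -
  have "0 \<le> (norm z / 2 - 1)\<^sup>2" by simp
  then have "norm z \<le> 1 + (norm z)\<^sup>2 / 4"
    by (simp add: power2_eq_square field_simps)
  then show ?thesis
    using exp_ge_add_one_self[of "(norm z)\<^sup>2 / 4"] by linarith
qed

lemma norm_gauss_squared: "norm (exp (- (z * cnj z))) = exp (- ((norm z)\<^sup>2))"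
proof -
  have "norm (exp (- (z * cnj z))) = norm (gauss z) * norm (gauss z)"
    by (simp only: gauss_squared[symmetric] norm_mult)
  then show ?thesis by (simp add: norm_gauss mult_exp_exp)
qed

text \<open>This is adjointness of differentiation against the constant function \<open>1\<close>, whose derivative is
  zero. The growth assumption on \<open>q\<close> passes, through Cauchy's inequality on unit circles, to its
  derivative at the cost of a factor \<open>exp (\<bar>z\<bar>\<^sup>2 / 4)\<close>, which the Gaussian weight still absorbs.\<close>
lemma integral_gauss_squared_moment:
  assumes q: "q holomorphic_on UNIV" and bound: "\<And>z. norm (gauss z * q z) \<le> B"
  shows "integrable lborel (\<lambda>z. exp (- (z * cnj z)) * (z * q z))"
    and "(LINT z|lborel. exp (- (z * cnj z)) * (z * q z)) = 0"
proof -
  have B: "0 \<le> B" using bound[of 0] norm_ge_zero order_trans by blast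
  have q_le: "norm (q z) \<le> B * exp ((norm z)\<^sup>2 / 2)" for z
    using bound[of z] by (simp add: norm_mult norm_gauss exp_minus field_simps)
  \<comment> \<open>Factors of size up to \<open>exp (3/4 \<bar>z\<bar>\<^sup>2 + 2)\<close> leave the integrable weight \<open>exp (- \<bar>z\<bar>\<^sup>2 / 4)\<close>; the
    constant \<open>2\<close> makes room for \<open>(\<bar>z\<bar> + 1)\<^sup>2 / 2 \<le> 3/4 \<bar>z\<bar>\<^sup>2 + 2\<close>, which bounds \<open>q\<close> on unit circles.\<close>
  define K where "K = B * exp 2"
  have int: "integrable lborel (\<lambda>z::complex. K * exp (- (1/4) * (norm z)\<^sup>2))"
    by (intro integrable_mult_right integrable_gaussian) simp
  have bound_by: "norm (exp (- (z * cnj z)) * x) \<le> K * exp (- (1/4) * (norm z)\<^sup>2)"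
    if "norm x \<le> K * exp (3/4 * (norm z)\<^sup>2)" for z x
  proof -
    have "norm (exp (- (z * cnj z)) * x) = exp (- ((norm z)\<^sup>2)) * norm x"
      by (simp only: norm_mult norm_gauss_squared)
    also have "\<dots> \<le> exp (- ((norm z)\<^sup>2)) * (K * exp (3/4 * (norm z)\<^sup>2))"
      using that by (intro mult_left_mono) auto
    also have "\<dots> = K * exp (- ((norm z)\<^sup>2) + 3/4 * (norm z)\<^sup>2)"
      by (simp only: mult_exp_exp[symmetric] mult_ac)
    also have "- ((norm z)\<^sup>2) + 3/4 * (norm z)\<^sup>2 = - (1/4) * (norm z)\<^sup>2" by simp
    finally show ?thesis .
  qed
  have K_le: "B * exp x \<le> K * exp (3/4 * (norm z)\<^sup>2)" if "x \<le> 3/4 * (norm z)\<^sup>2 + 2" for x and z :: complex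
    unfolding K_def mult.assoc mult_exp_exp using B that by (intro mult_left_mono) auto
  note cont = continuous_intros continuous_on_entire[OF q] continuous_on_entire[OF holomorphic_deriv_UNIV[OF q]]
  have 1: "integrable lborel (\<lambda>z. exp (- (z * cnj z)) * q z)"
  proof (rule integrable_continuous_bound[OF int])
    show "norm (exp (- (z * cnj z)) * q z) \<le> K * exp (- (1/4) * (norm z)\<^sup>2)" for z
    proof (intro bound_by order_trans[OF q_le] K_le)
      have "0 \<le> (norm z)\<^sup>2" by simp
      then show "(norm z)\<^sup>2 / 2 \<le> 3/4 * (norm z)\<^sup>2 + 2" by linarith
    qed
  qed (intro cont)
  have "norm (deriv q z) \<le> K * exp (3/4 * (norm z)\<^sup>2)" for z
  proof (rule entire_deriv_norm_le[OF q])
    fix v assume v: "norm (v - z) = 1"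
    have "norm v \<le> norm z + 1"
      using v norm_triangle_ineq[of "v - z" z] by simp
    then have "(norm v)\<^sup>2 \<le> (norm z + 1)\<^sup>2" by (intro power_mono) auto
    moreover have "0 \<le> (norm z - 2)\<^sup>2" by simp
    ultimately have "(norm v)\<^sup>2 / 2 \<le> 3/4 * (norm z)\<^sup>2 + 2"
      by (simp add: power2_eq_square field_simps)
    then show "norm (q v) \<le> K * exp (3/4 * (norm z)\<^sup>2)"
      by (intro order_trans[OF q_le] K_le)
  qed
  then have 2: "integrable lborel (\<lambda>z. exp (- (z * cnj z)) * deriv q z)"
    by (intro integrable_continuous_bound[OF int] cont bound_by)
  have "norm (z * q z) \<le> K * exp (3/4 * (norm z)\<^sup>2)" for z
  proof -
    have "norm (z * q z) \<le> exp ((norm z)\<^sup>2 / 4) * (B * exp ((norm z)\<^sup>2 / 2))"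
      unfolding norm_mult by (intro mult_mono norm_le_exp q_le) auto
    also have "\<dots> = B * exp ((norm z)\<^sup>2 / 4 + (norm z)\<^sup>2 / 2)"
      by (simp only: mult_exp_exp[symmetric] mult_ac)
    also have "\<dots> \<le> K * exp (3/4 * (norm z)\<^sup>2)" by (rule K_le) simp
    finally show ?thesis .
  qed
  then show 3: "integrable lborel (\<lambda>z. exp (- (z * cnj z)) * (z * q z))"
    by (intro integrable_continuous_bound[OF int] cont bound_by)
  show "(LINT z|lborel. exp (- (z * cnj z)) * (z * q z)) = 0"
    using fock_adjoint_deriv[of q "\<lambda>_. 1" 1] q 1 2 3 by simp
qed

text \<open>As for \<open>bump\<close>: the difference quotient \<open>q\<close> of \<open>h\<close> at the origin inherits the growth bound, by
  compactness inside the unit disc and because \<open>1 \<le> \<bar>z\<bar>\<close> outside it.\<close>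
lemma gaussian_mean_value:
  assumes h: "h holomorphic_on UNIV" and bound: "\<And>z. norm (gauss z * h z) \<le> B"
  shows "(LINT z|lborel. exp (- (z * cnj z)) * h z) = of_real pi * h 0"
proof -
  obtain q where q: "q holomorphic_on UNIV" and h_eq: "\<And>z. h z = h 0 + z * q z"
    using that by (rule entire_difference_quotient[OF h])
  have "compact (q ` cball 0 1)"
    by (intro compact_continuous_image continuous_on_subset[OF holomorphic_on_imp_continuous_on[OF q]]) auto
  then obtain M where M: "\<And>z. z \<in> cball 0 1 \<Longrightarrow> norm (q z) \<le> M"
    using compact_imp_bounded bounded_iff by (metis imageI)
  have "norm (gauss z * q z) \<le> max M (B + norm (h 0))" for z
  proof (cases "norm z \<le> 1")
    case True
    have "norm (gauss z * q z) \<le> 1 * norm (q z)"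
      unfolding norm_mult by (intro mult_right_mono) (auto simp: norm_gauss)
    then show ?thesis using M[of z] True by simp
  next
    case False
    have "norm (gauss z * q z) \<le> norm z * norm (gauss z * q z)"
      using False mult_right_mono[of 1 "norm z" "norm (gauss z * q z)"] by simp
    also have "\<dots> = norm (gauss z * (h z - h 0))"
      using h_eq[of z] by (simp add: norm_mult)
    also have "\<dots> \<le> norm (gauss z * h z) + norm (gauss z * h 0)"
      unfolding right_diff_distrib by (rule norm_triangle_ineq4)
    also have "\<dots> \<le> B + 1 * norm (h 0)"
      unfolding norm_mult[of _ "h 0"] by (intro add_mono bound mult_right_mono) (auto simp: norm_gauss)
    finally show ?thesis by simp
  qed
  note moment = integral_gauss_squared_moment[OF q this]
  have exp_eq: "exp (- (z * cnj z)) = of_real (exp (- 1 * (norm z)\<^sup>2))" for z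
    by (simp add: exp_of_real[symmetric] complex_norm_square[symmetric] del: exp_of_real)
  have "(LINT z|lborel. exp (- (z * cnj z))) = of_real pi"
    unfolding exp_eq using integral_gaussian[of 1] by simp
  moreover have "integrable lborel (\<lambda>z. exp (- (z * cnj z)))"
    unfolding exp_eq complex_of_real_integrable_eq by (rule integrable_gaussian) simp
  moreover have "exp (- (z * cnj z)) * h z = exp (- (z * cnj z)) * h 0 + exp (- (z * cnj z)) * (z * q z)" for z
    by (subst h_eq[of z]) (simp only: ring_distribs)
  ultimately show ?thesis
    using moment by simp
qed

text \<open>\<open>1 / pi\<close> times this is the integral kernel of the projection onto the Bargmann-Fock space.\<close>
definition fock_kernel :: "complex \<Rightarrow> complex \<Rightarrow> complex" where
  "fock_kernel z w = exp (- (z * cnj z) / 2 + z * cnj w - (w * cnj w) / 2)"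

lemma cnj_fock_kernel: "cnj (fock_kernel z w) = fock_kernel w z"
  by (simp add: fock_kernel_def exp_cnj algebra_simps)

lemma norm_fock_kernel: "norm (fock_kernel z w) = exp (- (1/2) * (norm (z - w))\<^sup>2)"
proof -
  have "Re (- (z * cnj z) / 2 + z * cnj w - (w * cnj w) / 2) = - (1/2) * (norm (z - w))\<^sup>2"
    unfolding cmod_power2 by (simp add: power2_eq_square field_simps)
  then show ?thesis by (simp only: fock_kernel_def norm_exp_eq_Re)
qed

text \<open>The Gaussian mean value property for the translate by \<open>a\<close>, after the substitution \<open>w = z + a\<close>.\<close>
lemma fock_reproducing:
  assumes h: "h holomorphic_on UNIV" and sq: "square_integrable (\<lambda>z. gauss z * h z)"
  shows "(LINT w|lborel. fock_kernel a w * (gauss w * h w)) = of_real pi * (gauss a * h a)"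
proof -
  obtain B where B: "\<And>z. norm (gauss z * h z) \<le> B"
    using fock_bounded[OF h sq] by blast
  define g where "g = (\<lambda>w. fock_kernel a w * (gauss w * h w))"
  have "g (z + a) = exp (- (z * cnj z)) * fock_translate a h z" for z
  proof -
    have "fock_kernel a (z + a) * gauss (z + a)
       = exp (- (z * cnj z)) * exp (- z * cnj a - a * cnj a / 2)"
      unfolding fock_kernel_def gauss_def mult_exp_exp
      by (rule arg_cong[of _ _ exp]) (simp add: field_simps)
    then show ?thesis by (simp add: g_def fock_translate_def mult_ac)
  qed
  moreover have "(LINT z|lborel. exp (- (z * cnj z)) * fock_translate a h z) = of_real pi * fock_translate a h 0"
    by (rule gaussian_mean_value[OF holomorphic_fock_translate[OF h], of _ B])
       (simp only: norm_gauss_fock_translate B)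
  moreover have "g \<in> borel_measurable borel"
    unfolding g_def fock_kernel_def
    by (intro borel_measurable_continuous_onI continuous_intros continuous_on_entire[OF h]) auto
  ultimately show ?thesis
    using integral_lborel_translation[of g a] by (simp add: fock_translate_0 g_def)
qed

text \<open>The projection is self-adjoint and fixes \<open>gauss * h\<close>, so it can be dropped when it is paired with
  an element of the space. Since \<open>gauss * h\<close> is bounded and the kernel is bounded by a Gaussian in
  \<open>z - w\<close>, integrability of \<open>F\<close> suffices for Fubini.\<close>
lemma fock_kernel_duality:
  assumes h: "h holomorphic_on UNIV" and sq: "square_integrable (\<lambda>z. gauss z * h z)"
    and cont: "continuous_on UNIV F" and int: "integrable lborel F"
  shows "(LINT z|lborel. cnj (gauss z * h z) * (LINT w|lborel. fock_kernel z w * F w))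
       = of_real pi * (LINT w|lborel. cnj (gauss w * h w) * F w)"
proof -
  obtain B where B: "\<And>z. norm (gauss z * h z) \<le> B"
    using fock_bounded[OF h sq] by blast
  then have B0: "0 \<le> B" using norm_ge_zero order_trans by blast
  define f where "f = (\<lambda>w z. cnj (gauss z * h z) * (fock_kernel z w * F w))"
  have cont_f: "continuous_on A (\<lambda>x. f (u x) (v x))" if "continuous_on A u" "continuous_on A v" for u v and A :: "'a :: topological_space set"
    unfolding f_def fock_kernel_def
    by (intro continuous_intros continuous_on_entire[OF h] continuous_on_compose2[OF cont] that) auto
  have norm_f: "norm (f w z) \<le> B * norm (F w) * exp (- (1/2) * (norm (z - w))\<^sup>2)" for w z
  proof -
    have "norm (f w z) = norm (gauss z * h z) * (exp (- (1/2) * (norm (z - w))\<^sup>2) * norm (F w))"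
      by (simp only: f_def norm_mult[of "cnj _"] complex_mod_cnj norm_mult[of "fock_kernel _ _"] norm_fock_kernel)
    also have "\<dots> \<le> B * (exp (- (1/2) * (norm (z - w))\<^sup>2) * norm (F w))"
      by (intro mult_right_mono B) simp
    finally show ?thesis by (simp add: mult_ac)
  qed
  have int_gauss: "integrable lborel (\<lambda>z. exp (- (1/2) * (norm (z - w))\<^sup>2))" for w :: complex
    using integrable_lborel_translation[of "\<lambda>z. exp (- (1/2) * (norm z)\<^sup>2)" "- w"] integrable_gaussian[of "1/2"]
    by simp
  have integral_gauss: "(LINT z|lborel. exp (- (1/2) * (norm (z - w))\<^sup>2)) = 2 * pi" for w :: complex
    using integral_lborel_translation[of "\<lambda>z. exp (- (1/2) * (norm z)\<^sup>2)" "- w"] integral_gaussian[of "1/2"]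
    by simp
  have int_f: "integrable lborel (f w)" for w
    by (rule integrable_continuous_bound[OF integrable_mult_right[OF int_gauss], OF _ norm_f])
       (intro cont_f continuous_intros)
  have f_meas: "case_prod f \<in> borel_measurable (lborel \<Otimes>\<^sub>M lborel)"
  proof -
    have "case_prod f \<in> borel_measurable borel"
      unfolding case_prod_beta by (intro borel_measurable_continuous_onI cont_f continuous_intros)
    then show ?thesis by (simp add: lborel_prod)
  qed
  have "integrable (lborel \<Otimes>\<^sub>M lborel) (case_prod f)"
  proof (rule lborel_pair.Fubini_integrable[OF f_meas])
    show "integrable lborel (\<lambda>w. LINT z|lborel. norm (case_prod f (w, z)))"
    proof (rule Bochner_Integration.integrable_bound)
      show "integrable lborel (\<lambda>w. B * norm (F w) * (2 * pi))"
        using int by (intro integrable_mult_left integrable_mult_right integrable_norm)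
      show "(\<lambda>w. LINT z|lborel. norm (case_prod f (w, z))) \<in> borel_measurable lborel"
        using f_meas by measurable
      show "AE w in lborel. norm (LINT z|lborel. norm (case_prod f (w, z))) \<le> norm (B * norm (F w) * (2 * pi))"
      proof (rule AE_I2)
        fix w
        have "(LINT z|lborel. norm (f w z)) \<le> (LINT z|lborel. B * norm (F w) * exp (- (1/2) * (norm (z - w))\<^sup>2))"
          by (intro integral_mono integrable_norm int_f integrable_mult_right int_gauss norm_f)
        also have "\<dots> = B * norm (F w) * (2 * pi)"
          by (simp only: integral_mult_right_zero integral_gauss)
        finally show "norm (LINT z|lborel. norm (case_prod f (w, z))) \<le> norm (B * norm (F w) * (2 * pi))"
          using B0 by simp
      qed
    qed
    show "AE w in lborel. integrable lborel (\<lambda>z. case_prod f (w, z))"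
      using int_f by simp
  qed
  then have "(LINT z|lborel. LINT w|lborel. f w z) = (LINT w|lborel. LINT z|lborel. f w z)"
    by (rule lborel_pair.Fubini_integral)
  also have "\<dots> = (LINT w|lborel. of_real pi * (cnj (gauss w * h w) * F w))"
  proof (rule Bochner_Integration.integral_cong[OF refl])
    fix w
    have "(LINT z|lborel. f w z) = (LINT z|lborel. cnj (fock_kernel w z * (gauss z * h z)) * F w)"
      by (simp only: f_def complex_cnj_mult cnj_fock_kernel mult_ac)
    also have "\<dots> = cnj (of_real pi * (gauss w * h w)) * F w"
      by (simp only: integral_mult_left_zero Bochner_Integration.integral_cnj fock_reproducing[OF h sq])
    finally show "(LINT z|lborel. f w z) = of_real pi * (cnj (gauss w * h w) * F w)"
      by simp
  qed
  finally show ?thesis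
    by (simp only: f_def integral_mult_right_zero)
qed

section \<open>The momentum identities\<close>

lemma fock_adjoint:
  assumes "F holomorphic_on UNIV" "G holomorphic_on UNIV"
    and "integrable lborel (\<lambda>z. (gauss z * F z) * cnj (gauss z * G z))"
        "integrable lborel (\<lambda>z. (gauss z * deriv F z) * cnj (gauss z * G z))"
        "integrable lborel (\<lambda>z. (gauss z * F z) * cnj (gauss z * deriv G z))"
        "integrable lborel (\<lambda>z. (gauss z * (z * F z)) * cnj (gauss z * G z))"
  shows "(LINT z|lborel. (gauss z * F z) * cnj (gauss z * deriv G z))
       = (LINT z|lborel. (gauss z * (z * F z)) * cnj (gauss z * G z))"
proof -
  have *: "(gauss z * x) * cnj (gauss z * y) = exp (- (of_real 1 * (z * cnj z))) * (x * cnj y)" for x y z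
    by (simp add: gauss_squared[symmetric])
  show ?thesis
    using fock_adjoint_deriv[of F G 1] assms unfolding * by (simp add: mult.assoc)
qed

lemma square_integrable_deriv:
  assumes f: "f holomorphic_on UNIV"
    and sq: "square_integrable (\<lambda>z. gauss z * f z)" "square_integrable (\<lambda>z. gauss z * (z * f z))"
  shows "square_integrable (\<lambda>z. gauss z * deriv f z)"
proof -
  have "square_integrable (\<lambda>z. gauss z * (cnj z * f z))"
    by (rule square_integrable_bound[OF sq(2), where B = 1])
       (auto simp: norm_mult intro!: continuous_intros continuous_on_entire[OF f])
  from square_integrable_add[OF square_integrable_twisted_deriv[OF f sq(1)] this]
  show ?thesis by (simp add: algebra_simps)
qed

text \<open>With the creation operator \<open>A\<close> (multiplication by \<open>z\<close>) and its adjoint \<open>A'\<close> (differentiation), the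
  second identity is the commutation relation \<open>A' A = 1 + A A'\<close> tested on \<open>f\<close>. Here \<open>z f'\<close> need not
  be square integrable, but all pairings that occur are integrable: the factor \<open>z\<close> can be moved
  to \<open>f\<close>, and \<open>f''\<close> enters only through the square integrable combination \<open>f'' - cnj z f'\<close>.\<close>
lemma fock_number_identities:
  assumes f: "f holomorphic_on UNIV"
    and sq: "square_integrable (\<lambda>z. gauss z * f z)" "square_integrable (\<lambda>z. gauss z * (z * f z))"
  shows "(LINT z|lborel. (gauss z * f z) * cnj (gauss z * deriv f z))
         = (LINT z|lborel. (gauss z * (z * f z)) * cnj (gauss z * f z))" (is ?A)
    and "(LINT z|lborel. (gauss z * f z) * cnj (gauss z * f z))
          + (LINT z|lborel. (gauss z * deriv f z) * cnj (gauss z * deriv f z))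
         = (LINT z|lborel. (gauss z * (z * f z)) * cnj (gauss z * (z * f z)))" (is ?B)
proof -
  note sq' = square_integrable_deriv[OF f sq]
  note f' = holomorphic_deriv_UNIV[OF f]
  note int = integrable_mult_cnj_square_integrable
  show ?A
    by (intro fock_adjoint f int sq sq')
  have zf: "(\<lambda>z. z * f z) holomorphic_on UNIV"
    by (intro holomorphic_intros f)
  have deriv_zf: "deriv (\<lambda>z. z * f z) z = f z + z * deriv f z" for z
  proof (rule DERIV_imp_deriv)
    have "(f has_field_derivative deriv f z) (at z)"
      using holomorphic_derivI[OF f] by simp
    then show "((\<lambda>z. z * f z) has_field_derivative f z + z * deriv f z) (at z)"
      by (auto intro!: derivative_eq_intros)
  qed
  have sq_cnj: "square_integrable (\<lambda>z. cnj z * (gauss z * f z))"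
    by (rule square_integrable_bound[OF sq(2), where B = 1])
       (auto simp: norm_mult intro!: continuous_intros continuous_on_entire[OF f])
  have int_zf': "integrable lborel (\<lambda>z. (gauss z * (z * deriv f z)) * cnj (gauss z * f z))"
    using int[OF sq' sq_cnj] by (simp add: mult_ac)
  \<comment> \<open>\<open>f'' cnj f = (f'' - cnj z f') cnj f + f' cnj (z f)\<close>, where both products pair square
    integrable functions.\<close>
  have "integrable lborel (\<lambda>z. (gauss z * (deriv (deriv f) z - cnj z * deriv f z)) * cnj (gauss z * f z)
       + (gauss z * deriv f z) * cnj (gauss z * (z * f z)))"
    by (intro Bochner_Integration.integrable_add int square_integrable_twisted_deriv f' sq sq')
  then have "integrable lborel (\<lambda>z. (gauss z * deriv (deriv f) z) * cnj (gauss z * f z))"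
    by (simp add: algebra_simps)
  then have 1: "(LINT z|lborel. (gauss z * deriv f z) * cnj (gauss z * deriv f z))
      = (LINT z|lborel. (gauss z * (z * deriv f z)) * cnj (gauss z * f z))"
    by (intro fock_adjoint[OF f' f int[OF sq' sq(1)] _ int[OF sq' sq'] int_zf'])
  have int_cnj: "integrable lborel (\<lambda>z. cnj ((gauss z * (z * deriv f z)) * cnj (gauss z * f z)))"
    using int_zf' by (rule integrable_cnj)
  have split: "(gauss z * f z) * cnj (gauss z * deriv (\<lambda>z. z * f z) z) =
      (gauss z * f z) * cnj (gauss z * f z) + cnj ((gauss z * (z * deriv f z)) * cnj (gauss z * f z))" for z
    by (simp add: deriv_zf algebra_simps)
  have "(LINT z|lborel. (gauss z * f z) * cnj (gauss z * deriv (\<lambda>z. z * f z) z))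
      = (LINT z|lborel. (gauss z * (z * f z)) * cnj (gauss z * (z * f z)))"
  proof -
    have "integrable lborel (\<lambda>z. (gauss z * f z) * cnj (gauss z * deriv (\<lambda>z. z * f z) z))"
      unfolding split by (intro Bochner_Integration.integrable_add int sq int_cnj)
    then show ?thesis
      by (rule fock_adjoint[OF f zf int[OF sq] int[OF sq' sq(2)] _ int[OF sq(2) sq(2)]])
  qed
  also have "(LINT z|lborel. (gauss z * f z) * cnj (gauss z * deriv (\<lambda>z. z * f z) z))
     = (LINT z|lborel. (gauss z * f z) * cnj (gauss z * f z))
       + cnj (LINT z|lborel. (gauss z * deriv f z) * cnj (gauss z * deriv f z))"
    unfolding split 1
    by (subst Bochner_Integration.integral_add[OF int[OF sq(1) sq(1)] int_cnj])
       (simp only: Bochner_Integration.integral_cnj)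
  also have "cnj (LINT z|lborel. (gauss z * deriv f z) * cnj (gauss z * deriv f z))
     = (LINT z|lborel. (gauss z * deriv f z) * cnj (gauss z * deriv f z))"
    unfolding Bochner_Integration.integral_cnj[symmetric]
    by (simp add: mult_ac)
  finally show ?B .
qed

text \<open>Along a solution \<open>u\<close> of \<open>\<i> \<partial>\<^sub>t u = \<Pi> F\<close>, the left-hand side is, up to the factor \<open>\<i>\<close>, the time
  derivative of \<open>\<langle>z u, u\<rangle> = \<integral> z \<bar>u\<bar>\<^sup>2\<close>. The profile equation \<open>eq\<close> evaluates it: the \<open>lam\<close> terms
  cancel by adjointness of differentiation and multiplication by \<open>z\<close>, the \<open>cnj \<alpha>\<close> terms are equal
  outright, and the \<open>\<alpha>\<close> terms combine to \<open>\<parallel>z f\<parallel>\<^sup>2 - \<parallel>f'\<parallel>\<^sup>2 = \<parallel>f\<parallel>\<^sup>2\<close> in the weighted norm.\<close>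
lemma momentum_balance:
  fixes lam :: real
  assumes f: "f holomorphic_on UNIV"
    and sq: "square_integrable (\<lambda>z. gauss z * f z)" "square_integrable (\<lambda>z. gauss z * (z * f z))"
    and F: "continuous_on UNIV F" "integrable lborel F"
    and eq: "\<And>z. (LINT w|lborel. fock_kernel z w * F w)
       = of_real pi * (gauss z * (of_real lam * f z + \<i> * \<alpha> * deriv f z - \<i> * cnj \<alpha> * (z * f z)))"
  shows "cnj (LINT z|lborel. cnj (gauss z * (z * f z)) * F z) - (LINT z|lborel. cnj (gauss z * deriv f z) * F z)
     = \<i> * \<alpha> * (LINT z|lborel. (gauss z * f z) * cnj (gauss z * f z))"
proof -
  note sq' = square_integrable_deriv[OF f sq]
  define ip where "ip = (\<lambda>X Y. LINT z|lborel. X (z :: complex) * cnj (Y z) :: complex)"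
  define U where "U = (\<lambda>z. gauss z * f z)"
  define D where "D = (\<lambda>z. gauss z * deriv f z)"
  define M where "M = (\<lambda>z. gauss z * (z * f z))"
  have sqs: "square_integrable U" "square_integrable D" "square_integrable M"
    using sq sq' by (auto simp: U_def D_def M_def)
  have cnj_ip: "cnj (ip X Y) = ip Y X" for X Y
    by (simp add: ip_def Bochner_Integration.integral_cnj[symmetric] mult.commute)
  have pairing: "(LINT z|lborel. cnj (gauss z * h z) * F z)
      = of_real lam * ip U H + \<i> * \<alpha> * ip D H - \<i> * cnj \<alpha> * ip M H"
    if h: "h holomorphic_on UNIV" and H: "square_integrable H" "H = (\<lambda>z. gauss z * h z)" for h H
  proof -
    have "of_real pi * (LINT z|lborel. cnj (gauss z * h z) * F z)
       = (LINT z|lborel. cnj (H z) * (of_real pi * (of_real lam * U z + \<i> * \<alpha> * D z - \<i> * cnj \<alpha> * M z)))"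
      using fock_kernel_duality[OF h _ F] H unfolding eq
      by (simp add: U_def D_def M_def algebra_simps)
    also have "\<dots> = (LINT z|lborel. of_real pi * (of_real lam * (U z * cnj (H z)) + \<i> * \<alpha> * (D z * cnj (H z))
         - \<i> * cnj \<alpha> * (M z * cnj (H z))))"
      by (simp add: algebra_simps)
    also have "\<dots> = of_real pi * (of_real lam * ip U H + \<i> * \<alpha> * ip D H - \<i> * cnj \<alpha> * ip M H)"
      using integrable_mult_cnj_square_integrable[OF _ H(1)] sqs by (simp add: ip_def)
    finally show ?thesis by simp
  qed
  have zf: "(\<lambda>z. z * f z) holomorphic_on UNIV" by (intro holomorphic_intros f)
  have M: "(LINT z|lborel. cnj (gauss z * (z * f z)) * F z)
      = of_real lam * ip U M + \<i> * \<alpha> * ip D M - \<i> * cnj \<alpha> * ip M M"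
    by (rule pairing[OF zf sqs(3)]) (simp add: M_def)
  have D: "(LINT z|lborel. cnj (gauss z * deriv f z) * F z)
      = of_real lam * ip U D + \<i> * \<alpha> * ip D D - \<i> * cnj \<alpha> * ip M D"
    by (rule pairing[OF holomorphic_deriv_UNIV[OF f] sqs(2)]) (simp add: D_def)
  have "ip U D = ip M U" "ip U U + ip D D = ip M M"
    using fock_number_identities[OF f sq] by (simp_all only: ip_def U_def D_def M_def)
  then have *: "ip M U = ip U D" "ip U U = ip M M - ip D D" by (simp_all add: algebra_simps)
  have UU: "(LINT z|lborel. (gauss z * f z) * cnj (gauss z * f z)) = ip U U"
    by (simp only: ip_def U_def)
  show ?thesis
    unfolding M D UU by (simp add: cnj_ip * algebra_simps)
qed

text \<open>Conservation of the total momentum \<open>\<integral> z (\<bar>u\<bar>\<^sup>2 + \<bar>v\<bar>\<^sup>2)\<close>. The four terms add up to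
  \<open>\<integral> (2 z k cnj k - k cnj k') exp (- 2 \<bar>z\<bar>\<^sup>2)\<close> for the product \<open>k = f g\<close>, which is zero by adjointness
  of differentiation for the doubled weight. The two components may
  exchange momentum, so only the sum of the two balances vanishes.\<close>
lemma momentum_cancellation:
  assumes f: "f holomorphic_on UNIV" and g: "g holomorphic_on UNIV"
    and sqf: "square_integrable (\<lambda>z. gauss z * f z)" "square_integrable (\<lambda>z. gauss z * (z * f z))"
    and sqg: "square_integrable (\<lambda>z. gauss z * g z)" "square_integrable (\<lambda>z. gauss z * (z * g z))"
  defines "U \<equiv> \<lambda>z. gauss z * f z" and "V \<equiv> \<lambda>z. gauss z * g z"
  shows "cnj (LINT z|lborel. cnj (gauss z * (z * f z)) * (of_real ((norm (V z))\<^sup>2) * U z))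
       - (LINT z|lborel. cnj (gauss z * deriv f z) * (of_real ((norm (V z))\<^sup>2) * U z))
       + (cnj (LINT z|lborel. cnj (gauss z * (z * g z)) * (of_real ((norm (U z))\<^sup>2) * V z))
       - (LINT z|lborel. cnj (gauss z * deriv g z) * (of_real ((norm (U z))\<^sup>2) * V z))) = 0"
proof -
  obtain Bf where Bf: "\<And>z. norm (U z) \<le> Bf"
    using fock_bounded[OF f sqf(1)] unfolding U_def by blast
  obtain Bg where Bg: "\<And>z. norm (V z) \<le> Bg"
    using fock_bounded[OF g sqg(1)] unfolding V_def by blast
  \<comment> \<open>With \<open>k = f g\<close>: \<open>X\<close>, \<open>Y + Z\<close> and \<open>M\<close> are \<open>k\<close>, \<open>k'\<close> and \<open>z k\<close> weighted by \<open>gauss\<^sup>2\<close>. Each is a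
    bounded function times a square integrable one.\<close>
  define X where "X = (\<lambda>z. U z * V z)"
  define Y where "Y = (\<lambda>z. (gauss z * deriv f z) * V z)"
  define Z where "Z = (\<lambda>z. U z * (gauss z * deriv g z))"
  define M where "M = (\<lambda>z. z * (U z * V z))"
  have V: "continuous_on UNIV V" and U: "continuous_on UNIV U"
    unfolding U_def V_def by (intro continuous_intros continuous_on_entire[OF f] continuous_on_entire[OF g])+
  have X: "square_integrable X"
    using square_integrable_mult_bounded[OF sqf(1) V Bg] by (simp add: X_def U_def mult_ac)
  have M: "square_integrable M"
    using square_integrable_mult_bounded[OF sqf(2) V Bg] by (simp add: M_def U_def mult_ac)
  have Y: "square_integrable Y"
    using square_integrable_mult_bounded[OF square_integrable_deriv[OF f sqf] V Bg]
    by (simp add: Y_def mult_ac)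
  have Z: "square_integrable Z"
    using square_integrable_mult_bounded[OF square_integrable_deriv[OF g sqg] U Bf]
    by (simp add: Z_def mult_ac)
  note int = integrable_mult_cnj_square_integrable
  define k where "k = (\<lambda>z. f z * g z)"
  have k: "k holomorphic_on UNIV" unfolding k_def by (intro holomorphic_intros f g)
  have deriv_k: "deriv k z = deriv f z * g z + f z * deriv g z" for z
  proof (rule DERIV_imp_deriv)
    have "(f has_field_derivative deriv f z) (at z)" "(g has_field_derivative deriv g z) (at z)"
      using holomorphic_derivI[OF f] holomorphic_derivI[OF g] by auto
    then show "(k has_field_derivative deriv f z * g z + f z * deriv g z) (at z)"
      unfolding k_def by (auto intro!: derivative_eq_intros)
  qed
  have w: "exp (- (of_real 2 * (z * cnj z))) = gauss z * gauss z * (gauss z * gauss z)" for z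
    unfolding gauss_squared mult_exp_exp by (rule arg_cong[of _ _ exp]) simp
  have adj: "(LINT z|lborel. X z * cnj (Y z + Z z)) = 2 * (LINT z|lborel. M z * cnj (X z))"
  proof -
    have e: "exp (- (of_real 2 * (z * cnj z))) * (k z * cnj (k z)) = X z * cnj (X z)"
       "exp (- (of_real 2 * (z * cnj z))) * (deriv k z * cnj (k z)) = (Y z + Z z) * cnj (X z)"
       "exp (- (of_real 2 * (z * cnj z))) * (k z * cnj (deriv k z)) = X z * cnj (Y z + Z z)"
       "exp (- (of_real 2 * (z * cnj z))) * (z * k z * cnj (k z)) = M z * cnj (X z)" for z
      unfolding w deriv_k by (simp_all add: X_def Y_def Z_def M_def U_def V_def k_def algebra_simps)
    show ?thesis
      using fock_adjoint_deriv[OF k k, of 2, unfolded e,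
          OF int[OF X X] int[OF square_integrable_add[OF Y Z] X]
             int[OF X square_integrable_add[OF Y Z]] int[OF M X]]
      by simp
  qed
  have 1: "cnj (LINT z|lborel. cnj (gauss z * (z * f z)) * (of_real ((norm (V z))\<^sup>2) * U z))
      = (LINT z|lborel. M z * cnj (X z))"
    unfolding Bochner_Integration.integral_cnj[symmetric]
    by (simp add: complex_norm_square M_def X_def U_def V_def mult_ac del: of_real_power)
  have 2: "cnj (LINT z|lborel. cnj (gauss z * (z * g z)) * (of_real ((norm (U z))\<^sup>2) * V z))
      = (LINT z|lborel. M z * cnj (X z))"
    unfolding Bochner_Integration.integral_cnj[symmetric]
    by (simp add: complex_norm_square M_def X_def U_def V_def mult_ac del: of_real_power)
  have 3: "(LINT z|lborel. cnj (gauss z * deriv f z) * (of_real ((norm (V z))\<^sup>2) * U z))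
      = (LINT z|lborel. X z * cnj (Y z))"
    by (simp add: complex_norm_square Y_def X_def mult_ac del: of_real_power)
  have 4: "(LINT z|lborel. cnj (gauss z * deriv g z) * (of_real ((norm (U z))\<^sup>2) * V z))
      = (LINT z|lborel. X z * cnj (Z z))"
    by (simp add: complex_norm_square Z_def X_def mult_ac del: of_real_power)
  have "(LINT z|lborel. X z * cnj (Y z)) + (LINT z|lborel. X z * cnj (Z z))
      = 2 * (LINT z|lborel. M z * cnj (X z))"
    unfolding adj[symmetric] complex_cnj_add ring_distribs
    by (rule Bochner_Integration.integral_add[OF int[OF X Y] int[OF X Z], symmetric])
  then show ?thesis unfolding 1 2 3 4 by (simp add: algebra_simps)
qed

section \<open>Travelling waves\<close>

lemma fock_projection_eq:
  assumes "continuous_on UNIV F"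
  shows "fock_projection F z = of_real (1 / pi) * (LINT w|lborel. fock_kernel z w * F w)"
proof -
  have "continuous_on UNIV (\<lambda>w. exp (cnj w * z - of_real ((norm w)\<^sup>2 / 2)) * F w)"
    by (intro continuous_intros assms) auto
  then have "(LINT w|lebesgue. exp (cnj w * z - of_real ((norm w)\<^sup>2 / 2)) * F w)
      = (LINT w|lborel. exp (cnj w * z - of_real ((norm w)\<^sup>2 / 2)) * F w)"
    by (intro integral_completion) (simp add: borel_measurable_continuous_onI)
  then have *: "fock_projection F z = of_real (1 / pi) *
      (LINT w|lborel. gauss z * (exp (cnj w * z - of_real ((norm w)\<^sup>2 / 2)) * F w))"
    by (simp add: fock_projection_def gauss_eq_of_real)
  have "gauss z * (exp (cnj w * z - of_real ((norm w)\<^sup>2 / 2)) * F w) = fock_kernel z w * F w" for w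
    by (simp add: gauss_def fock_kernel_def mult_exp_exp complex_norm_square mult.assoc[symmetric]
        algebra_simps del: of_real_power)
  then show ?thesis unfolding * by (simp only:)
qed

lemma bargmann_fock_L21_cases:
  assumes "U \<in> bargmann_fock_L21"
  obtains f where "f holomorphic_on UNIV" "U = (\<lambda>z. gauss z * f z)"
    "square_integrable (\<lambda>z. gauss z * f z)" "square_integrable (\<lambda>z. gauss z * (z * f z))"
proof -
  obtain f where f: "f holomorphic_on UNIV" "U = (\<lambda>z. gauss z * f z)"
    using assms by (auto simp: bargmann_fock_L21_def bargmann_fock_def gauss_eq_of_real)
  have cont: "continuous_on UNIV U"
    unfolding f(2) by (intro continuous_intros continuous_on_entire[OF f(1)])
  have sq: "square_integrable X" if "X \<in> L2" "continuous_on UNIV X" for X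
  proof -
    have "(\<lambda>z. (norm (X z))\<^sup>2) \<in> borel_measurable lborel"
      using that(2) by (simp add: borel_measurable_continuous_onI continuous_intros)
    then show ?thesis
      using that by (simp add: square_integrable_def L2_def integrable_completion)
  qed
  have "U \<in> L2" "(\<lambda>z. of_real (japanese_bracket z) * U z) \<in> L2"
    using assms by (auto simp: bargmann_fock_L21_def bargmann_fock_def)
  then have 1: "square_integrable U" and 2: "square_integrable (\<lambda>z. of_real (japanese_bracket z) * U z)"
    by (auto intro!: sq cont continuous_intros simp: japanese_bracket_def)
  have "square_integrable (\<lambda>z. gauss z * (z * f z))"
  proof (rule square_integrable_bound[OF 2, where B = 1])
    show "norm (gauss z * (z * f z)) \<le> 1 * norm (of_real (japanese_bracket z) * U z)" for z
    proof -
      have "norm z \<le> japanese_bracket z"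
        unfolding japanese_bracket_def by (rule real_le_rsqrt) simp
      then have "norm z * norm (U z) \<le> \<bar>japanese_bracket z\<bar> * norm (U z)"
        by (intro mult_right_mono) auto
      then show ?thesis by (simp add: f(2) norm_mult mult_ac)
    qed
  qed (intro continuous_intros continuous_on_entire[OF f(1)])
  with f 1 show thesis by (intro that) auto
qed

text \<open>The phase factor in the travelling profile is exactly the one that turns the shift of the
  Gaussian into a factor holomorphic in \<open>z\<close>. For real \<open>s\<close> the profile then agrees with a function
  \<open>K\<close> that is complex differentiable in \<open>s\<close>, and the chain rule applies.\<close>
lemma travelling_profile_derivative:
  assumes f: "f holomorphic_on UNIV"
  shows "((\<lambda>s. travelling_profile lam \<alpha> (\<lambda>z. gauss z * f z) s z) has_vector_derivative
      gauss z * (- \<i> * of_real lam * f z + \<alpha> * deriv f z - cnj \<alpha> * (z * f z))) (at 0)"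
proof -
  define K where "K = (\<lambda>s. gauss z * (exp (- \<i> * of_real lam * s) * f (z + \<alpha> * s)
      * exp (- (z * cnj \<alpha> * s) - \<alpha> * cnj \<alpha> / 2 * s\<^sup>2)))"
  have "travelling_profile lam \<alpha> (\<lambda>z. gauss z * f z) s z = K (of_real s)" for s
  proof -
    have "gauss (z + \<alpha> * of_real s) * exp (1 / 2 * (cnj z * \<alpha> - z * cnj \<alpha>) * of_real s)
       = gauss z * exp (- (z * cnj \<alpha> * of_real s) - \<alpha> * cnj \<alpha> / 2 * (of_real s)\<^sup>2)"
      unfolding gauss_def mult_exp_exp
      by (rule arg_cong[of _ _ exp]) (simp add: field_simps power2_eq_square)
    then show ?thesis by (simp add: travelling_profile_def K_def mult_ac)
  qed
  moreover have "(K has_field_derivative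
      gauss z * (- \<i> * of_real lam * f z + \<alpha> * deriv f z - cnj \<alpha> * (z * f z))) (at (of_real 0))"
  proof -
    have "(f has_field_derivative deriv f z) (at (z + \<alpha> * of_real 0))"
      using holomorphic_derivI[OF f, of z] by simp
    moreover have "((\<lambda>s. z + \<alpha> * s) has_field_derivative \<alpha>) (at (of_real 0))"
      by (auto intro!: derivative_eq_intros)
    ultimately have "((\<lambda>s. f (z + \<alpha> * s)) has_field_derivative deriv f z * \<alpha>) (at (of_real 0))"
      by (rule DERIV_chain2)
    then show ?thesis
      unfolding K_def by (auto intro!: derivative_eq_intros simp: algebra_simps)
  qed
  ultimately show ?thesis
    using has_vector_derivative_real_field[of K _ 0 UNIV] by simp
qed

lemma stationary_equation:
  assumes f: "f holomorphic_on UNIV" and F: "continuous_on UNIV F"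
    and eq: "\<And>z. \<i> * vector_derivative (\<lambda>s. travelling_profile lam \<alpha> (\<lambda>z. gauss z * f z) s z) (at 0)
        = fock_projection F z"
  shows "(LINT w|lborel. fock_kernel z w * F w)
       = of_real pi * (gauss z * (of_real lam * f z + \<i> * \<alpha> * deriv f z - \<i> * cnj \<alpha> * (z * f z)))"
proof -
  have "(LINT w|lborel. fock_kernel z w * F w) = of_real pi * fock_projection F z"
    by (simp add: fock_projection_eq[OF F])
  also have "fock_projection F z
      = \<i> * (gauss z * (- \<i> * of_real lam * f z + \<alpha> * deriv f z - cnj \<alpha> * (z * f z)))"
    unfolding eq[of z, symmetric] vector_derivative_at[OF travelling_profile_derivative[OF f]] ..
  also have "\<dots> = gauss z * (of_real lam * f z + \<i> * \<alpha> * deriv f z - \<i> * cnj \<alpha> * (z * f z))"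
    by (simp add: algebra_simps)
  finally show ?thesis .
qed

lemma integrable_cubic:
  assumes "square_integrable U" "square_integrable V" "\<And>z. norm (U z) \<le> B"
  shows "continuous_on UNIV (\<lambda>z. of_real ((norm (V z))\<^sup>2) * U z)"
    and "integrable lborel (\<lambda>z. of_real ((norm (V z))\<^sup>2) * U z)"
proof -
  show *: "continuous_on UNIV (\<lambda>z. of_real ((norm (V z))\<^sup>2) * U z)"
    using assms by (auto simp: square_integrable_def intro!: continuous_intros)
  have "integrable lborel (\<lambda>z. (norm (V z))\<^sup>2 * B)"
    using assms by (simp add: square_integrable_def)
  then show "integrable lborel (\<lambda>z. of_real ((norm (V z))\<^sup>2) * U z)"
    by (rule integrable_continuous_bound[OF _ *])
       (simp add: norm_mult norm_power mult_left_mono assms(3))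
qed

lemma square_integral_eq_0:
  assumes "square_integrable X" "(LINT z|lborel. (norm (X z))\<^sup>2) = 0"
  shows "X = (\<lambda>_. 0)"
proof
  fix z
  have "(norm (X z))\<^sup>2 = 0"
    using assms by (intro continuous_integral_eq_0_imp_eq_0[of "\<lambda>z. (norm (X z))\<^sup>2"])
       (auto simp: square_integrable_def intro!: continuous_intros)
  then show "X z = 0" by simp
qed

theorem proposition1p4:
  "\<not> (\<exists>(U :: complex \<Rightarrow> complex) (V :: complex \<Rightarrow> complex) (lam :: real) (mu :: real) (\<alpha> :: complex).
        U \<in> bargmann_fock_L21 \<and> V \<in> bargmann_fock_L21 \<and>
        (U, V) \<noteq> ((\<lambda>_. 0), (\<lambda>_. 0)) \<and> \<alpha> \<noteq> 0 \<and>
        is_solution (travelling_profile lam \<alpha> U) (travelling_profile mu \<alpha> V))"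
proof (intro notI, elim exE conjE)
  fix U V :: "complex \<Rightarrow> complex" and lam mu :: real and \<alpha> :: complex
  assume U: "U \<in> bargmann_fock_L21" and V: "V \<in> bargmann_fock_L21"
    and nontrivial: "(U, V) \<noteq> ((\<lambda>_. 0), (\<lambda>_. 0))" and \<alpha>: "\<alpha> \<noteq> 0"
    and sol: "is_solution (travelling_profile lam \<alpha> U) (travelling_profile mu \<alpha> V)"
  obtain f where f: "f holomorphic_on UNIV" and U_eq: "U = (\<lambda>z. gauss z * f z)"
    and sqf: "square_integrable (\<lambda>z. gauss z * f z)" "square_integrable (\<lambda>z. gauss z * (z * f z))"
    using bargmann_fock_L21_cases[OF U] by metis
  obtain g where g: "g holomorphic_on UNIV" and V_eq: "V = (\<lambda>z. gauss z * g z)"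
    and sqg: "square_integrable (\<lambda>z. gauss z * g z)" "square_integrable (\<lambda>z. gauss z * (z * g z))"
    using bargmann_fock_L21_cases[OF V] by metis
  have sqU: "square_integrable U" and sqV: "square_integrable V"
    using sqf sqg by (simp_all add: U_eq V_eq)
  obtain BU where BU: "\<And>z. norm (U z) \<le> BU"
    using fock_bounded[OF f sqf(1)] unfolding U_eq by blast
  obtain BV where BV: "\<And>z. norm (V z) \<le> BV"
    using fock_bounded[OF g sqg(1)] unfolding V_eq by blast
  have at_0: "travelling_profile l \<alpha> X 0 = X" for l X
    by (simp add: travelling_profile_def fun_eq_iff)
  have "\<i> * vector_derivative (\<lambda>s. travelling_profile lam \<alpha> U s z) (at 0)
        = fock_projection (\<lambda>w. of_real ((norm (V w))\<^sup>2) * U w) z"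
    and "\<i> * vector_derivative (\<lambda>s. travelling_profile mu \<alpha> V s z) (at 0)
        = fock_projection (\<lambda>w. of_real ((norm (U w))\<^sup>2) * V w) z" for z
    using sol unfolding is_solution_def by (metis at_0)+
  then have eq_u: "\<i> * vector_derivative (\<lambda>s. travelling_profile lam \<alpha> (\<lambda>z. gauss z * f z) s z) (at 0)
        = fock_projection (\<lambda>w. of_real ((norm (V w))\<^sup>2) * U w) z"
    and eq_v: "\<i> * vector_derivative (\<lambda>s. travelling_profile mu \<alpha> (\<lambda>z. gauss z * g z) s z) (at 0)
        = fock_projection (\<lambda>w. of_real ((norm (U w))\<^sup>2) * V w) z" for z
    unfolding U_eq[symmetric] V_eq[symmetric] by blast+
  note FU = integrable_cubic[OF sqU sqV BU] and FV = integrable_cubic[OF sqV sqU BV]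
  have Uz: "gauss z * f z = U z" and Vz: "gauss z * g z = V z" for z
    by (simp_all add: U_eq V_eq)
  have bal_u: "cnj (LINT z|lborel. cnj (gauss z * (z * f z)) * (of_real ((norm (V z))\<^sup>2) * U z))
       - (LINT z|lborel. cnj (gauss z * deriv f z) * (of_real ((norm (V z))\<^sup>2) * U z))
       = \<i> * \<alpha> * (LINT z|lborel. (gauss z * f z) * cnj (gauss z * f z))"
    by (rule momentum_balance[OF f sqf FU stationary_equation[OF f FU(1) eq_u]])
  have bal_v: "cnj (LINT z|lborel. cnj (gauss z * (z * g z)) * (of_real ((norm (U z))\<^sup>2) * V z))
       - (LINT z|lborel. cnj (gauss z * deriv g z) * (of_real ((norm (U z))\<^sup>2) * V z))
       = \<i> * \<alpha> * (LINT z|lborel. (gauss z * g z) * cnj (gauss z * g z))"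
    by (rule momentum_balance[OF g sqg FV stationary_equation[OF g FV(1) eq_v]])
  have "\<i> * \<alpha> * (LINT z|lborel. (gauss z * f z) * cnj (gauss z * f z))
      + \<i> * \<alpha> * (LINT z|lborel. (gauss z * g z) * cnj (gauss z * g z)) = 0"
    unfolding bal_u[symmetric] bal_v[symmetric]
    by (rule momentum_cancellation[OF f g sqf sqg, unfolded Uz Vz])
  then have "\<i> * \<alpha> * (of_real (LINT z|lborel. (norm (U z))\<^sup>2) + of_real (LINT z|lborel. (norm (V z))\<^sup>2)) = 0"
    unfolding integral_complex_of_real[symmetric] complex_norm_square U_eq V_eq
    by (simp only: ring_distribs)
  then have "of_real ((LINT z|lborel. (norm (U z))\<^sup>2) + (LINT z|lborel. (norm (V z))\<^sup>2)) = (0::complex)"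
    using \<alpha> by simp
  then have "(LINT z|lborel. (norm (U z))\<^sup>2) + (LINT z|lborel. (norm (V z))\<^sup>2) = 0"
    by (simp only: of_real_eq_0_iff)
  moreover have "0 \<le> (LINT z|lborel. (norm (U z))\<^sup>2)" "0 \<le> (LINT z|lborel. (norm (V z))\<^sup>2)"
    by simp_all
  ultimately have "(LINT z|lborel. (norm (U z))\<^sup>2) = 0" "(LINT z|lborel. (norm (V z))\<^sup>2) = 0"
    by linarith+
  then have "U = (\<lambda>_. 0)" "V = (\<lambda>_. 0)"
    using square_integral_eq_0[OF sqU] square_integral_eq_0[OF sqV] by blast+
  with nontrivial show False by simp
qed

end
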